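(* Let $\kappa_1=\rho\|\mathcal A^\top\mathcal A\|$, $\kappa_2=\rho\|\mathcal B^\top\mathcal B\|$, $\kappa_3=\rho\|\mathcal A^\top\mathcal B\|$ (spectral norms), and suppose that $\mu,\beta,\tau,\sigma$ satisfy $$0<\sigma<\tfrac1{24},\qquad \beta>\frac{4\kappa_1}{1-24\sigma}\Big(4+3\sigma+\sqrt{24-168\sigma+9\sigma^2}\Big)>0,\qquad \mu>\kappa_2+\frac{16\kappa_3^2}{\sigma\beta}>0,$$ $$\max\Big\{\frac\beta2,\ \frac{\beta}{24\sigma}\Big(1-\frac{16\kappa_1}{\beta}-\sqrt{\varsigma}\Big)\Big\}<\tau<\frac{\beta}{24\sigma}\Big(1-\frac{16\kappa_1}{\beta}+\sqrt{\varsigma}\Big),$$ where $\varsigma=1-\frac{32\kappa_1}{\beta}-\frac{128\kappa_1^2}{\beta^2}-\frac{24\kappa_1\sigma}{\beta}-24\sigma>0$. Let $\{(\widetilde W_k,\widetilde P_k,z_k,u_k)\}_{k\ge0}$ be generated, from an initial point $(\widetilde W_0,\widetilde P_0,z_0,u_0)$, by the PALM iteration $$\begin{aligned} &\widetilde P_{k+1}\in\mathbf{prox}_{\mu^{-1}g}\big(\widetilde P_k-\mu^{-1}\nabla_{\widetilde P}H(\widetilde W_k,\widetilde P_k)\big),\\ &z_{k+1}\in\mathbf{prox}_{\beta^{-1}f}\big(\widetilde W_k+\beta^{-1}u_k\big),\\ &\widetilde W_{k+1}=\widetilde W_k-\tau^{-1}\big(\nabla_{\widetilde W}H(\widetilde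 W_k,\widetilde P_{k+1})+u_k+\beta(\widetilde W_k-z_{k+1})\big),\\ &u_{k+1}=u_k+\sigma\beta(\widetilde W_{k+1}-z_{k+1}), \end{aligned}$$ and let $(\widetilde W^*,\widetilde P^*,z^*,u^* )$ be its limit. Let $\theta\in(0,1)$ be the Łojasiewicz exponent of the regularized augmented Lagrangian $\Psi$. Then: (1) if $\theta\in(0,1/2]$, there exist $k_0\ge0$, constants $P_{0,1},P_{0,2},P_{0,3},P_{0,4}>0$ and $r\in(0,1)$ such that for all $k\ge k_0$ $$\|\widetilde W_k-\widetilde W^*\|\le P_{0,1}r^k,\quad \|\widetilde P_k-\widetilde P^*\|\le P_{0,2}r^k,\quad \|z_k-z^*\|\le P_{0,3}r^k,\quad \|u_k-u^*\|\le P_{0,4}r^k;$$ (2) if $\theta\in(1/2,1)$, there exist $k_1\ge0$ and constants $P_{1,1},P_{1,2},P_{1,3},P_{1,4}>0$ such that for all $k\ge k_1$ $$\|\widetilde W_k-\widetilde W^*\|\le P_{1,1}k^{-\frac{1-\theta}{2\theta-1}},\quad \|\widetilde P_k-\widetilde P^*\|\le P_{1,2}k^{-\frac{1-\theta}{2\theta-1}},\quad \|z_k-z^*\|\le P_{1,3}k^{-\frac{1-\theta}{2\theta-1}},\quad \|u_k-u^*\|\le P_{1,4}k^{-\frac{1-\theta}{2\theta-1}}.$$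
   Context: Data. Let $m,n,l,q,M\ge 1$ be integers and $p=m+n$; let $m=\sum_{i=1}^s m_i$, $n=\sum_{j=1}^t n_j$ be partitions into positive integers. Let $A\in\mathbb R^{n\times n}$, $B_2\in\mathbb R^{n\times m}$, $B_1\in\mathbb R^{n\times l}$, $C\in\mathbb R^{q\times n}$, $D\in\mathbb R^{q\times m}$. Put $Q=\begin{bmatrix}B_1B_1^\top&0\\0&0\end{bmatrix}$, $R=\begin{bmatrix}C^\top C&0\\0&D^\top D\end{bmatrix}$ in $\mathbb S^p$ (symmetric $p\times p$ matrices), $F_i=\begin{bmatrix}A_i&B_{2,i}\\0&0\end{bmatrix}\in\mathbb R^{p\times p}$ ($i=1,\dots,M$) given, with $A_i\in\mathbb R^{n\times n}$, $B_{2,i}\in\mathbb R^{n\times m}$. Put $V_1=[0,I_m]\in\mathbb R^{m\times p}$, $V_2=[I_n,0]\in\mathbb R^{n\times p}$ and $\Upsilon_i(W)=-V_2(F_iW+WF_i^\top+Q)V_2^\top$. Standing assumptions. (1) $C^\top D=0$, $D^\top D\succ0$, $C^\top C\succ0$, $B_1B_1^\top\succ0$, $(A,B_2)$ is stabilizable, and $(A,C)$ has no unobservable modes on the imaginary axis. (2) $\begin{bmatrix}A&B_2\\0&0\end{bmatrix}$ is a convex combination of $F_1,\dots,F_M$. (3) There is $W\in\mathbb S^p$ with $W\succ0$ and $\Upsilon_i(W)\succ0$ for all $i$. (4) Every $W\in\mathbb S^p$ with $W\succeq0$ and $\Upsilon_i(W)\succeq0$ for all $i$ has positive definite upper-left $n\times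 n$ block. Functions. $\mathrm{vec}$ stacks columns; $\Gamma_+^k=\{\mathrm{vec}(S):S\in\mathbb S^k,\ S\succeq0\}$; $\delta_E$ is the indicator function ($0$ on $E$, $+\infty$ off $E$). For $\widetilde W\in\mathbb R^{p^2}$, $\widetilde P\in\mathbb R^{mn}$, with $W=\mathrm{vec}^{-1}(\widetilde W)\in\mathbb R^{p\times p}$, $$f(\widetilde W)=\langle\mathrm{vec}(R),\widetilde W\rangle+\delta_{\Gamma_+^p}(\widetilde W)+\sum_{i=1}^M\delta_{\Gamma_+^n}(\mathrm{vec}(\Upsilon_i(W))),\qquad g(\widetilde P)=\gamma\,\|\mathrm{vec}^{-1}(\widetilde P)\|_{s,t;0},$$ where $\gamma>0$ and $\|P\|_{s,t;0}$ is the number of nonzero blocks $P_{ij}\in\mathbb R^{m_i\times n_j}$ of $P=(P_{ij})_{i\le s,j\le t}\in\mathbb R^{m\times n}$. Coupling. Let $N=t(t-1)/2$ and let $(\xi(j),\kappa(j))$, $j=1,\dots,N$, enumerate lexicographically the pairs $(a,b)$ with $1\le a<b\le t$. For $a\le t$ let $E_a=[0_{n_a\times\sum_{r<a}n_r},\ I_{n_a},\ 0]\in\mathbb R^{n_a\times p}$, and put $V_{j1}=E_{\xi(j)}$, $V_{j2}=E_{\kappa(j)}^\top$. Let $\mathcal A$ be the matrix obtained by stacking vertically $V_{12}^\top\otimes V_{11},\dots,V_{N2}^\top\otimes V_{N1}$, $V_2\otimes V_1$, and let $\mathcal B$ be obtained by stacking vertically zero blocks (matching the first $N$ blocks of $\mathcal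 A$) and $-I_{mn}$. For $\rho>0$ set $H(\widetilde W,\widetilde P)=\frac\rho2\|\mathcal A\widetilde W+\mathcal B\widetilde P\|^2$. The proximal operator is the (set-valued) map $\mathbf{prox}_{\alpha h}(z)=\operatorname{argmin}_y\{h(y)+\frac1{2\alpha}\|y-z\|^2\}$ for $\alpha>0$. Under the parameter conditions of the claim, the PALM sequence converges, so its limit $(\widetilde W^*,\widetilde P^*,z^*,u^* )$ is meaningful. Regularized augmented Lagrangian. For $\mathbf X=(\widetilde W,\widetilde P,z,u,\widetilde W',u')\in\mathbb R^{p^2}\times\mathbb R^{mn}\times\mathbb R^{p^2}\times\mathbb R^{p^2}\times\mathbb R^{p^2}\times\mathbb R^{p^2}$, $$\Psi(\mathbf X)=f(z)+g(\widetilde P)+H(\widetilde W,\widetilde P)+\langle u,\widetilde W-z\rangle+\tfrac\beta2\|\widetilde W-z\|^2+C_0\|(u-u')+\sigma(\tau-\beta)(\widetilde W-\widetilde W')\|^2+C_1\|\widetilde W-\widetilde W'\|^2,$$ with $C_0=\frac{4(1-\sigma)}{\sigma^2\beta}$, $C_1=\frac{8(\sigma\tau+\kappa_1)^2}{\sigma\beta}$. Łojasiewicz property. The limiting subdifferential $\partial\psi(x)$ is the set of $d$ for which there are $x_k\to x$, $d_k\to d$ with $\psi(x_k)\to\psi(x)$, $d_k\in\hat\partial\psi(x_k)$, where $\hat\partial\psi(x)=\{d:\liminf_{y\to x,\,y\neq x}\frac{\psi(y)-\psi(x)-\langle d,y-x\rangle}{\|y-x\|}\ge0\}$; both are empty off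 $\mathrm{dom}\,\psi$. A proper lower semicontinuous $\psi$ satisfies the Łojasiewicz property with Łojasiewicz exponent $\theta\in[0,1)$ if for every critical point $\hat v$ of $\psi$ (i.e. $0\in\partial\psi(\hat v)$) there are $c>0$, $\epsilon>0$ such that $|\psi(v)-\psi(\hat v)|^\theta\le c\,\mathrm{dist}(0,\partial\psi(v))$ for all $v$ in the open ball of center $\hat v$ and radius $\epsilon$. *)

theory Defs
  imports "HOL-Analysis.Analysis"
begin

text \<open>
  An r-by-c matrix has type \<open>real^'c^'r\<close>. The index type of \<open>\<real>\<^sup>p\<close>, p = n + m, is \<open>'n + 'm\<close>,
  with the \<open>'n\<close> part first.
\<close>

definition posdef :: "real^'k^'k \<Rightarrow> bool" where
  "posdef S \<longleftrightarrow> transpose S = S \<and> (\<forall>x. x \<noteq> 0 \<longrightarrow> 0 < x \<bullet> (S *v x))"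

definition possemidef :: "real^'k^'k \<Rightarrow> bool" where
  "possemidef S \<longleftrightarrow> transpose S = S \<and> (\<forall>x. 0 \<le> x \<bullet> (S *v x))"

definition spectral_norm :: "real^'c^'r \<Rightarrow> real" where
  "spectral_norm X = onorm (\<lambda>x. X *v x)"

definition block_matrix ::
  "real^'n::finite^'n \<Rightarrow> real^'m::finite^'n \<Rightarrow> real^'n^'m \<Rightarrow> real^'m^'m \<Rightarrow> real^('n + 'm)^('n + 'm)" where
  "block_matrix X11 X12 X21 X22 =
     (\<chi> i j. case (i, j) of
        (Inl a, Inl b) \<Rightarrow> X11 $ a $ b
      | (Inl a, Inr b) \<Rightarrow> X12 $ a $ b
      | (Inr a, Inl b) \<Rightarrow> X21 $ a $ b
      | (Inr a, Inr b) \<Rightarrow> X22 $ a $ b)"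

text \<open>
  Column stacking: the coordinates of \<open>vec X\<close> are indexed by pairs (column, row), the column
  being the major index. (The library constant \<open>vec\<close> is the constant vector, hence the name.)
\<close>

definition mvec :: "real^'c::finite^'r::finite \<Rightarrow> real^('c \<times> 'r)" where
  "mvec X = (\<chi> k. X $ snd k $ fst k)"

definition unvec :: "real^('c::finite \<times> 'r::finite) \<Rightarrow> real^'c^'r" where
  "unvec x = (\<chi> i j. x $ (j, i))"


definition complex_matrix :: "real^'c^'r \<Rightarrow> complex^'c^'r" where
  "complex_matrix X = map_matrix complex_of_real X"

definition hurwitz :: "real^'k^'k \<Rightarrow> bool" where
  "hurwitz X \<longleftrightarrow>
     (\<forall>ev v. v \<noteq> 0 \<and> complex_matrix X *v v = ev *s v \<longrightarrow> Re ev < 0)"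

definition stabilizable :: "real^'n^'n \<Rightarrow> real^'m^'n \<Rightarrow> bool" where
  "stabilizable A B \<longleftrightarrow> (\<exists>K :: real^'n^'m. hurwitz (A + B ** K))"

definition unobservable_mode :: "real^'n^'n \<Rightarrow> real^'n^'q \<Rightarrow> complex \<Rightarrow> bool" where
  "unobservable_mode A C ev \<longleftrightarrow>
     (\<exists>v. v \<noteq> 0 \<and> complex_matrix A *v v = ev *s v \<and> complex_matrix C *v v = 0)"


definition Q_mat :: "real^'l^'n \<Rightarrow> real^('n::finite + 'm::finite)^('n + 'm)" where
  "Q_mat B1 = block_matrix (B1 ** transpose B1) 0 0 0"

definition R_mat :: "real^'n^'q \<Rightarrow> real^'m^'q \<Rightarrow> real^('n::finite + 'm::finite)^('n + 'm)" where
  "R_mat C D = block_matrix (transpose C ** C) 0 0 (transpose D ** D)"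

definition F_mat :: "real^'n^'n \<Rightarrow> real^'m^'n \<Rightarrow> real^('n::finite + 'm::finite)^('n + 'm)" where
  "F_mat A B2 = block_matrix A B2 0 0"

definition V1 :: "real^('n::finite + 'm::finite)^'m" where
  "V1 = (\<chi> i. axis (Inr i) 1)"

definition V2 :: "real^('n::finite + 'm::finite)^'n" where
  "V2 = (\<chi> i. axis (Inl i) 1)"

definition Upsilon ::
  "real^('n::finite + 'm::finite)^('n + 'm) \<Rightarrow> real^('n + 'm)^('n + 'm) \<Rightarrow> real^('n + 'm)^('n + 'm) \<Rightarrow> real^'n^'n" where
  "Upsilon Q F W = - (V2 ** (F ** W + W ** transpose F + Q) ** transpose V2)"

definition upper_left :: "real^('n::finite + 'm::finite)^('n + 'm) \<Rightarrow> real^'n^'n" where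
  "upper_left W = (\<chi> i j. W $ Inl i $ Inl j)"


definition psd_cone :: "(real^('k::finite \<times> 'k)) set" where
  "psd_cone = {mvec S | S. possemidef S}"

definition delta :: "'a set \<Rightarrow> 'a \<Rightarrow> ereal" where
  "delta E x = (if x \<in> E then 0 else \<infinity>)"

definition f_fun ::
  "real^('n::finite + 'm::finite)^('n + 'm) \<Rightarrow> real^('n + 'm)^('n + 'm) \<Rightarrow> (nat \<Rightarrow> real^('n + 'm)^('n + 'm)) \<Rightarrow> nat
    \<Rightarrow> real^(('n + 'm) \<times> ('n + 'm)) \<Rightarrow> ereal" where
  "f_fun R Q F M Wt =
     ereal (mvec R \<bullet> Wt) + delta psd_cone Wt
     + (\<Sum>i=1..M. delta psd_cone (mvec (Upsilon Q (F i) (unvec Wt))))"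

text \<open>
  A partition \<open>CARD('k) = d 1 + \<dots> + d c\<close> cuts the linearly ordered index type \<open>'k\<close> into
  consecutive blocks; \<open>block d a\<close> lists the indices of the \<open>a\<close>-th one in increasing order.
\<close>

definition partition_sizes :: "nat \<Rightarrow> (nat \<Rightarrow> nat) \<Rightarrow> nat \<Rightarrow> bool" where
  "partition_sizes N d c \<longleftrightarrow> (\<forall>a\<in>{1..c}. 0 < d a) \<and> (\<Sum>a=1..c. d a) = N"

definition indices :: "'k :: {finite, linorder} list" where
  "indices = sorted_list_of_set UNIV"

definition block :: "(nat \<Rightarrow> nat) \<Rightarrow> nat \<Rightarrow> 'k :: {finite, linorder} list" where
  "block d a = take (d a) (drop (\<Sum>r\<in>{1..<a}. d r) indices)"

definition block_l0 ::
  "(nat \<Rightarrow> nat) \<Rightarrow> nat \<Rightarrow> (nat \<Rightarrow> nat) \<Rightarrow> nat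
    \<Rightarrow> real^'n::{finite, linorder}^'m::{finite, linorder} \<Rightarrow> nat" where
  "block_l0 ms s ns t P =
     card {(i, j). i \<in> {1..s} \<and> j \<in> {1..t}
                 \<and> (\<exists>a\<in>set (block ms i). \<exists>b\<in>set (block ns j). P $ a $ b \<noteq> 0)}"

definition g_fun ::
  "real \<Rightarrow> (nat \<Rightarrow> nat) \<Rightarrow> nat \<Rightarrow> (nat \<Rightarrow> nat) \<Rightarrow> nat
    \<Rightarrow> real^('n::{finite, linorder} \<times> 'm::{finite, linorder}) \<Rightarrow> ereal" where
  "g_fun gam ms s ns t Pt = ereal (gam * real (block_l0 ms s ns t (unvec Pt)))"


text \<open>
  The number of rows of the matrices below depends on the terms \<open>ns\<close> and \<open>t\<close>, so it cannot be
  a type. A matrix with columns indexed by \<open>'c\<close> is therefore given as the list of its rows, of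
  type \<open>(real^'c) list\<close>; vertical stacking is concatenation. The columns of a Kronecker product
  are indexed by pairs in the order used for \<^const>\<open>mvec\<close>, so that
  (X \<open>\<otimes>\<close> Y) vec W = vec (Y W X\<open>\<^sup>T\<close>).
\<close>

definition row_list :: "real^'c^'r::{finite, linorder} \<Rightarrow> (real^'c) list" where
  "row_list X = map (\<lambda>i. X $ i) indices"

definition kronecker :: "(real^'c::finite) list \<Rightarrow> (real^'d::finite) list \<Rightarrow> (real^('c \<times> 'd)) list" where
  "kronecker X Y = [\<chi> k. x $ fst k * y $ snd k. x \<leftarrow> X, y \<leftarrow> Y]"

definition E_rows :: "(nat \<Rightarrow> nat) \<Rightarrow> nat \<Rightarrow> (real^('n::{finite, linorder} + 'm::finite)) list" where
  "E_rows ns a = map (\<lambda>i. axis (Inl i) 1) (block ns a)"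

definition lex_pairs :: "nat \<Rightarrow> (nat \<times> nat) list" where
  "lex_pairs t = [(a, b). a \<leftarrow> [1..<Suc t], b \<leftarrow> [Suc a..<Suc t]]"

definition A_offdiag ::
  "(nat \<Rightarrow> nat) \<Rightarrow> nat
    \<Rightarrow> (real^(('n::{finite, linorder} + 'm::{finite, linorder}) \<times> ('n + 'm))) list" where
  "A_offdiag ns t = concat (map (\<lambda>(a, b). kronecker (E_rows ns b) (E_rows ns a)) (lex_pairs t))"

definition A_rows ::
  "(nat \<Rightarrow> nat) \<Rightarrow> nat
    \<Rightarrow> (real^(('n::{finite, linorder} + 'm::{finite, linorder}) \<times> ('n + 'm))) list" where
  "A_rows ns t = A_offdiag ns t
     @ kronecker (row_list V2) (row_list V1)"

text \<open>The rows of \<open>-I\<close> follow the order of the rows of the last Kronecker product above.\<close>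

definition B_rows ::
  "(nat \<Rightarrow> nat) \<Rightarrow> nat \<Rightarrow> (real^('n::{finite, linorder} \<times> 'm::{finite, linorder})) list" where
  "B_rows ns t =
     replicate (length (A_offdiag ns t :: (real^(('n + 'm) \<times> ('n + 'm))) list)) 0
     @ [- axis (i, k) 1. i \<leftarrow> indices, k \<leftarrow> indices]"

text \<open>The matrix X\<open>\<^sup>T\<close>Y for X, Y given by the same number of rows.\<close>

definition transpose_mult :: "(real^'c) list \<Rightarrow> (real^'d) list \<Rightarrow> real^'d^'c" where
  "transpose_mult X Y = (\<chi> i j. \<Sum>k<length X. (X ! k) $ i * (Y ! k) $ j)"

definition H_fun ::
  "real \<Rightarrow> (real^'c) list \<Rightarrow> (real^'d) list \<Rightarrow> real^'c \<Rightarrow> real^'d \<Rightarrow> real" where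
  "H_fun rho X Y Wt Pt = rho / 2 * (\<Sum>k<length X. ((X ! k) \<bullet> Wt + (Y ! k) \<bullet> Pt)\<^sup>2)"


definition gradient :: "('a::real_inner \<Rightarrow> real) \<Rightarrow> 'a \<Rightarrow> 'a" where
  "gradient h x = (THE D. GDERIV h x :> D)"

definition prox :: "real \<Rightarrow> ('a::real_inner \<Rightarrow> ereal) \<Rightarrow> 'a \<Rightarrow> 'a set" where
  "prox alpha h z =
     {y. is_arg_min (\<lambda>y. h y + ereal (1 / (2 * alpha) * (norm (y - z))\<^sup>2)) (\<lambda>_. True) y}"

definition edom :: "('a \<Rightarrow> ereal) \<Rightarrow> 'a set" where
  "edom psi = {x. psi x < \<infinity>}"

definition proper_fun :: "('a \<Rightarrow> ereal) \<Rightarrow> bool" where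
  "proper_fun psi \<longleftrightarrow> (\<forall>x. psi x \<noteq> -\<infinity>) \<and> edom psi \<noteq> {}"

definition lower_semicontinuous :: "('a::topological_space \<Rightarrow> ereal) \<Rightarrow> bool" where
  "lower_semicontinuous psi \<longleftrightarrow> (\<forall>x. psi x \<le> Liminf (at x) psi)"

definition frechet_subdiff :: "('a::euclidean_space \<Rightarrow> ereal) \<Rightarrow> 'a \<Rightarrow> 'a set" where
  "frechet_subdiff psi x =
     {d. x \<in> edom psi \<and>
         0 \<le> Liminf (at x) (\<lambda>y. (psi y - psi x - ereal (d \<bullet> (y - x))) / ereal (norm (y - x)))}"

definition limiting_subdiff :: "('a::euclidean_space \<Rightarrow> ereal) \<Rightarrow> 'a \<Rightarrow> 'a set" where
  "limiting_subdiff psi x =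
     {d. x \<in> edom psi \<and>
         (\<exists>xs ds. xs \<longlonglongrightarrow> x \<and> ds \<longlonglongrightarrow> d \<and> (\<lambda>k. psi (xs k)) \<longlonglongrightarrow> psi x \<and>
                  (\<forall>k. ds k \<in> frechet_subdiff psi (xs k)))}"

text \<open>
  Distance from the origin with the convention dist(0, \<open>{}\<close>) = \<open>\<infinity>\<close>; the library's
  \<^const>\<open>infdist\<close> is 0 for the empty set.
\<close>

definition dist0 :: "'a::real_normed_vector set \<Rightarrow> ereal" where
  "dist0 S = (INF d\<in>S. ereal (norm d))"

text \<open>Power of a nonnegative extended real; only used with nonnegative base and exponent.\<close>

definition epowr :: "ereal \<Rightarrow> real \<Rightarrow> ereal" where
  "epowr x a = (case x of ereal r \<Rightarrow> ereal (r powr a) | PInfty \<Rightarrow> \<infinity> | MInfty \<Rightarrow> 0)"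

definition lojasiewicz :: "('a::euclidean_space \<Rightarrow> ereal) \<Rightarrow> real \<Rightarrow> bool" where
  "lojasiewicz psi \<theta> \<longleftrightarrow>
     proper_fun psi \<and> lower_semicontinuous psi \<and> 0 \<le> \<theta> \<and> \<theta> < 1 \<and>
     (\<forall>vhat. 0 \<in> limiting_subdiff psi vhat \<longrightarrow>
        (\<exists>c>0. \<exists>\<epsilon>>0. \<forall>v\<in>ball vhat \<epsilon>.
           epowr \<bar>psi v - psi vhat\<bar> \<theta> \<le> ereal c * dist0 (limiting_subdiff psi v)))"

definition Psi ::
  "('w::euclidean_space \<Rightarrow> ereal) \<Rightarrow> ('p::euclidean_space \<Rightarrow> ereal) \<Rightarrow> ('w \<Rightarrow> 'p \<Rightarrow> real)
    \<Rightarrow> real \<Rightarrow> real \<Rightarrow> real \<Rightarrow> real \<Rightarrow> 'w \<times> 'p \<times> 'w \<times> 'w \<times> 'w \<times> 'w \<Rightarrow> ereal" where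
  "Psi f g H \<sigma> \<tau> \<beta> \<kappa>\<^sub>1 = (\<lambda>(W, P, z, u, W', u').
     (let C0 = 4 * (1 - \<sigma>) / (\<sigma>\<^sup>2 * \<beta>);
          C1 = 8 * (\<sigma> * \<tau> + \<kappa>\<^sub>1)\<^sup>2 / (\<sigma> * \<beta>)
      in f z + g P
         + ereal (H W P + u \<bullet> (W - z) + \<beta> / 2 * (norm (W - z))\<^sup>2
                  + C0 * (norm ((u - u') + (\<sigma> * (\<tau> - \<beta>)) *\<^sub>R (W - W')))\<^sup>2
                  + C1 * (norm (W - W'))\<^sup>2)))"

end

theory Submission
  imports Defs
begin

text \<open>
  The method is a descent method for the regularized augmented Lagrangian \<open>\<Psi>\<close>, evaluated at the
  current iterate together with the previous values of \<open>W\<close> and \<open>u\<close>. The steps in \<open>P\<close>, \<open>z\<close> and \<open>W\<close>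
  decrease the augmented Lagrangian by multiples of the squared steps in \<open>P\<close> and \<open>W\<close>; the multiplier
  step increases it by \<open>\<parallel>\<Delta>u\<parallel>\<^sup>2 / (\<sigma>\<beta>)\<close>. With \<open>v = \<Delta>u + \<sigma>(\<tau> - \<beta>)\<Delta>W\<close>, the update rule for \<open>W\<close> gives
  \<open>v\<^sub>k\<^sub>+\<^sub>1 = (1 - \<sigma>) v\<^sub>k + \<sigma> e\<^sub>k\<close> with \<open>e\<^sub>k\<close> bounded by the steps in \<open>W\<close> and \<open>P\<close>, so the correction terms
  in \<open>\<Psi>\<close> absorb that increase. The coefficient of \<open>-\<parallel>\<Delta>W\<parallel>\<^sup>2\<close> that remains is a quadratic polynomial in
  \<open>\<tau>\<close> with discriminant \<open>\<varsigma>\<close>, and the bounds on \<open>\<tau>\<close> and \<open>\<mu>\<close> make all remaining coefficients positive: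
  this is the sufficient decrease property \<open>palm.\<psi>r_descent\<close>.

  Since the coupling is quadratic, a proximal step yields a global quadratic minorant of \<open>\<Psi>\<close>, hence a
  Frechet subgradient at the current iterate, which depends linearly on the last step
  (\<open>palm.d_subgradient\<close>, \<open>palm.d_bound\<close>). Lower semicontinuity of \<open>\<Psi>\<close> and the minimality in the
  proximal steps show that \<open>\<Psi>\<close> converges along the iteration to its value at the limit point, which is
  therefore critical (\<open>palm.Xstar_critical\<close>).

  The Lojasiewicz inequality at that point turns this into two scalar inequalities for the gap \<open>E\<^sub>k\<close>
  of \<open>\<Psi>\<close> and the step length \<open>a\<^sub>k\<close>, namely \<open>E\<^sub>k\<^sub>+\<^sub>1 + c a\<^sub>k\<^sub>+\<^sub>1\<^sup>2 \<le> E\<^sub>k\<close> and \<open>E\<^sub>k\<^sup>\<theta> \<le> C a\<^sub>k\<close> for large \<open>k\<close>. They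
  imply that the length of the path from index \<open>k + 1\<close> on is at most a multiple of \<open>E\<^sub>k\<close> to the power \<open>min (1/2) (1 - \<theta>)\<close>, and
  that \<open>E\<^sub>k - E\<^sub>k\<^sub>+\<^sub>1\<close> is at least a multiple of \<open>E\<^sub>k\<^sub>+\<^sub>1\<close> to the power \<open>2\<theta>\<close>. The second fact gives geometric
  decay of the gap for \<open>\<theta> \<le> 1/2\<close> and decay like \<open>k\<close> to the power \<open>-1/(2\<theta> - 1)\<close> for \<open>\<theta> > 1/2\<close>; the first
  one transfers these rates to the iterates.
\<close>

section \<open>Rates from sufficient decrease and the Lojasiewicz inequality\<close>

text \<open>
  The supergradient inequality of the concave function \<open>w \<mapsto> w powr (1 - \<theta>)\<close> at \<open>x\<close>, multiplied by
  \<open>x powr \<theta>\<close> so that no division by \<open>x\<close> occurs.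
\<close>

lemma powr_concave_diff:
  fixes x y \<theta> :: real
  assumes "0 < x" "0 \<le> y" "0 < \<theta>" "\<theta> < 1"
  shows "(1 - \<theta>) * (x - y) \<le> x powr \<theta> * (x powr (1 - \<theta>) - y powr (1 - \<theta>))"
proof -
  have "x powr \<theta> * y powr (1 - \<theta>) \<le> \<theta> * x + (1 - \<theta>) * y"
    using assms Youngs_inequality_0[of \<theta> "1 - \<theta>" x y] by (cases "y = 0") auto
  moreover have "x powr \<theta> * x powr (1 - \<theta>) = x"
    using assms by (simp flip: powr_add)
  ultimately show ?thesis
    by (simp add: algebra_simps)
qed

text \<open>
  The scalar situation behind convergence rates of descent methods: \<open>E k\<close> is the gap between the
  current and the limiting value of the merit function, \<open>a k\<close> the length of a step. The gap
  decreases by a multiple of the squared step, and from index \<open>K\<close> on the Lojasiewicz inequality,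
  combined with a subgradient of size \<open>O(a k)\<close>, bounds a power of the gap by the step.
\<close>

locale loj_descent =
  fixes E a :: "nat \<Rightarrow> real" and c C \<theta> :: real and K :: nat
  assumes c_pos: "0 < c" and C_pos: "0 < C" and \<theta>_pos: "0 < \<theta>" and \<theta>_less: "\<theta> < 1"
    and E_nonneg: "0 \<le> E k" and a_nonneg: "0 \<le> a k"
    and descent: "E (Suc k) + c * (a (Suc k))\<^sup>2 \<le> E k"
    and error_bound: "K \<le> k \<Longrightarrow> E k powr \<theta> \<le> C * a k"
    and E_tendsto: "E \<longlonglongrightarrow> 0"
begin

lemma E_Suc_le: "E (Suc k) \<le> E k"
  using descent[of k] c_pos by (smt (verit) mult_nonneg_nonneg zero_le_power2)

lemma a_Suc_le: "a (Suc k) \<le> (1 / sqrt c) * E k powr (1/2)"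
proof -
  have "(a (Suc k))\<^sup>2 \<le> E k / c"
    using descent[of k] E_nonneg[of "Suc k"] c_pos by (simp add: field_simps)
  then have "a (Suc k) \<le> sqrt (E k / c)"
    by (rule real_le_rsqrt)
  then show ?thesis
    using E_nonneg[of k] by (simp add: real_sqrt_divide powr_half_sqrt)
qed

text \<open>
  Multiplying the descent inequality by the supergradient inequality for \<open>E powr (1 - \<theta>)\<close> yields
  \<open>(a (Suc k))\<^sup>2 \<le> a k * (\<dots>)\<close> with a telescoping second factor; the arithmetic-geometric mean
  inequality makes this linear.
\<close>

lemma two_a_Suc_le:
  assumes "K \<le> k"
  shows "2 * a (Suc k) \<le> a k + C / (c * (1 - \<theta>)) * (E k powr (1 - \<theta>) - E (Suc k) powr (1 - \<theta>))"
proof -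
  let ?\<phi> = "E k powr (1 - \<theta>) - E (Suc k) powr (1 - \<theta>)"
  let ?M = "C / (c * (1 - \<theta>))"
  have M: "0 < ?M" using c_pos C_pos \<theta>_less by simp
  have \<phi>: "0 \<le> ?\<phi>"
    using E_Suc_le[of k] E_nonneg \<theta>_less by (simp add: powr_mono2)
  have "(a (Suc k))\<^sup>2 \<le> a k * (?M * ?\<phi>)"
  proof (cases "E k = 0")
    case True
    then have "c * (a (Suc k))\<^sup>2 \<le> 0" using descent[of k] E_nonneg[of "Suc k"] by linarith
    then have "(a (Suc k))\<^sup>2 \<le> 0" using c_pos by (simp add: mult_le_0_iff)
    moreover have "0 \<le> a k * (?M * ?\<phi>)" using a_nonneg M \<phi> by (simp del: times_divide_eq_left)
    ultimately show ?thesis by linarith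
  next
    case False
    then have pos: "0 < E k" using E_nonneg[of k] by simp
    have "(1 - \<theta>) * (c * (a (Suc k))\<^sup>2) \<le> (1 - \<theta>) * (E k - E (Suc k))"
      using descent[of k] \<theta>_less by (intro mult_left_mono) auto
    also have "\<dots> \<le> E k powr \<theta> * ?\<phi>"
      using powr_concave_diff[OF pos E_nonneg \<theta>_pos \<theta>_less] .
    also have "\<dots> \<le> C * a k * ?\<phi>"
      using error_bound[OF assms] \<phi> by (rule mult_right_mono)
    finally show ?thesis using c_pos \<theta>_less by (simp add: field_simps)
  qed
  also have "\<dots> \<le> ((a k + ?M * ?\<phi>) / 2)\<^sup>2"
  proof -
    have "p * q \<le> ((p + q) / 2)\<^sup>2" for p q :: real
      using zero_le_power2[of "p - q"] by (simp add: power2_eq_square algebra_simps)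
    then show ?thesis .
  qed
  finally have "a (Suc k) \<le> (a k + ?M * ?\<phi>) / 2"
    by (rule power2_le_imp_le) (use a_nonneg M \<phi> in \<open>simp del: times_divide_eq_left\<close>)
  then show ?thesis by simp
qed

lemma tail_sum_le:
  assumes "K \<le> k"
  shows "sum a {Suc k..<n} \<le> a k + C / (c * (1 - \<theta>)) * E k powr (1 - \<theta>)"
proof (cases "Suc k \<le> n")
  case True
  let ?M = "C / (c * (1 - \<theta>))"
  have M: "0 < ?M" using c_pos C_pos \<theta>_less by simp
  \<comment> \<open>the invariant is the telescoped form of the previous lemma\<close>
  have "sum a {Suc k..<n} + a (n - 1) \<le> a k + ?M * (E k powr (1 - \<theta>) - E (n - 1) powr (1 - \<theta>))"
    using True
  proof (induction n rule: dec_induct)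
    case base
    then show ?case by simp
  next
    case (step n)
    then obtain j where n: "n = Suc j" by (cases n) auto
    have "2 * a (Suc j) \<le> a j + ?M * (E j powr (1 - \<theta>) - E (Suc j) powr (1 - \<theta>))"
      using step n assms by (intro two_a_Suc_le) auto
    then show ?case using step n by (simp add: algebra_simps)
  qed
  moreover have "0 \<le> ?M * E (n - 1) powr (1 - \<theta>)" using M by (simp del: times_divide_eq_left)
  ultimately show ?thesis using a_nonneg[of "n - 1"] by (simp only: right_diff_distrib)
next
  case False
  then show ?thesis using a_nonneg[of k] c_pos C_pos \<theta>_less by simp
qed

text \<open>
  The length of the remaining path from index \<open>Suc k\<close> on is controlled by the gap alone. The
  exponent \<open>1/2\<close> comes from single steps, the exponent \<open>1 - \<theta>\<close> from the telescoping sum.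
\<close>

lemma path_length_le:
  obtains B K' where "0 < B"
    and "\<And>k n. K' \<le> k \<Longrightarrow> sum a {Suc k..<n} \<le> B * E k powr min (1/2) (1 - \<theta>)"
proof -
  let ?e = "min (1/2) (1 - \<theta>)" and ?M = "C / (c * (1 - \<theta>))"
  have M: "0 < ?M" using c_pos C_pos \<theta>_less by simp
  obtain K1 where K1: "\<And>k. K1 \<le> k \<Longrightarrow> E k < 1"
    using order_tendstoD(2)[OF E_tendsto, of 1] by (auto simp: eventually_sequentially)
  have "sum a {Suc k..<n} \<le> (2 / sqrt c + ?M) * E k powr ?e" if k: "max K K1 \<le> k" for k n
  proof -
    have small: "E k powr p \<le> E k powr ?e" if "?e \<le> p" for p
      using K1[of k] E_nonneg[of k] k that \<theta>_less by (intro powr_mono') auto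
    have E1: "E (Suc k) powr (1 - \<theta>) \<le> E k powr (1 - \<theta>)"
      using E_Suc_le E_nonneg \<theta>_less by (intro powr_mono2) auto
    have "sum a {Suc k..<n} \<le> a (Suc k) + sum a {Suc (Suc k)..<n}"
    proof (cases "Suc k < n")
      case True
      then show ?thesis by (simp add: sum.atLeast_Suc_lessThan)
    next
      case False
      then show ?thesis using a_nonneg[of "Suc k"] by simp
    qed
    also have "\<dots> \<le> 2 * a (Suc k) + ?M * E (Suc k) powr (1 - \<theta>)"
      using tail_sum_le[of "Suc k" n] k by simp
    also have "\<dots> \<le> 2 * ((1 / sqrt c) * E k powr ?e) + ?M * E k powr ?e"
    proof (intro add_mono mult_left_mono)
      show "a (Suc k) \<le> (1 / sqrt c) * E k powr ?e"
        using a_Suc_le[of k] small[of "1/2"] c_pos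
        by (smt (verit) divide_nonneg_nonneg min.cobounded1 mult_left_mono real_sqrt_ge_zero)
      show "E (Suc k) powr (1 - \<theta>) \<le> E k powr ?e"
        using E1 small[of "1 - \<theta>"] by linarith
    qed (use M in auto)
    finally show ?thesis by (simp add: algebra_simps)
  qed
  moreover have "0 < 2 / sqrt c + ?M" using c_pos M by (simp add: add_pos_pos)
  ultimately show ?thesis by (rule that[rotated])
qed

lemma E_recursion:
  assumes "K \<le> Suc k"
  shows "E (Suc k) + c / C\<^sup>2 * E (Suc k) powr (2 * \<theta>) \<le> E k"
proof -
  have "E (Suc k) powr (2 * \<theta>) = (E (Suc k) powr \<theta>)\<^sup>2"
    by (simp add: power2_eq_square flip: powr_add)
  also have "\<dots> \<le> (C * a (Suc k))\<^sup>2"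
    using error_bound[OF assms] by (intro power_mono) auto
  finally have "c / C\<^sup>2 * E (Suc k) powr (2 * \<theta>) \<le> c / C\<^sup>2 * (C * a (Suc k))\<^sup>2"
    using c_pos by (intro mult_left_mono) auto
  also have "\<dots> = c * (a (Suc k))\<^sup>2"
    using C_pos by (simp add: power_mult_distrib)
  finally show ?thesis using descent[of k] by linarith
qed

text \<open>
  The exponents \<open>k + 2\<close> here and \<open>real (k + 2)\<close> in the next lemma are chosen because the distances
  of the iterates of index \<open>k + 2\<close> to the limit are bounded in terms of \<open>E k\<close> below.
\<close>

lemma E_linear_rate:
  assumes "\<theta> \<le> 1/2"
  obtains B r K' where "0 < B" "0 < r" "r < 1"
    and "\<And>k. K' \<le> k \<Longrightarrow> E k \<le> B * r ^ (k + 2)"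
proof -
  define r where "r = 1 / (1 + c / C\<^sup>2)"
  have cC: "0 < c / C\<^sup>2" using c_pos C_pos by simp
  have r: "0 < r" "r < 1" using cC unfolding r_def by (auto simp: add_pos_pos)
  obtain K1 where K1: "\<And>k. K1 \<le> k \<Longrightarrow> E k < 1"
    using order_tendstoD(2)[OF E_tendsto, of 1] by (auto simp: eventually_sequentially)
  define K' where "K' = max K K1"
  have step: "E (Suc k) \<le> r * E k" if k: "K' \<le> k" for k
  proof -
    have "E (Suc k) powr 1 \<le> E (Suc k) powr (2 * \<theta>)"
      using K1[of "Suc k"] E_nonneg[of "Suc k"] k assms \<theta>_pos unfolding K'_def
      by (intro powr_mono') auto
    then have "c / C\<^sup>2 * E (Suc k) \<le> c / C\<^sup>2 * E (Suc k) powr (2 * \<theta>)"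
      using cC E_nonneg[of "Suc k"] by (intro mult_left_mono) auto
    then have "(1 + c / C\<^sup>2) * E (Suc k) \<le> E k"
      using E_recursion[of k] k unfolding K'_def by (simp add: algebra_simps)
    then show ?thesis using cC unfolding r_def by (simp add: field_simps)
  qed
  define B where "B = (E K' + 1) / r ^ (K' + 2)"
  have "E k \<le> B * r ^ (k + 2)" if "K' \<le> k" for k
    using that
  proof (induction k rule: dec_induct)
    case base
    then show ?case using r by (simp add: B_def)
  next
    case (step k)
    have "E (Suc k) \<le> r * E k" using step by (intro \<open>\<And>k. K' \<le> k \<Longrightarrow> E (Suc k) \<le> r * E k\<close>)
    also have "\<dots> \<le> r * (B * r ^ (k + 2))" using step r by (intro mult_left_mono) auto
    finally show ?case by (simp add: mult_ac)
  qed
  moreover have "0 < B" using E_nonneg[of K'] r unfolding B_def by simp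
  ultimately show ?thesis using r that by blast
qed

text \<open>
  By induction: \<open>w + const * w powr (2 * \<theta>)\<close> is increasing in \<open>w\<close>, so if the bound failed at
  \<open>Suc k\<close> the recursion would make \<open>E k\<close> exceed its own bound.
\<close>

lemma E_sublinear_rate:
  assumes "1/2 < \<theta>"
  obtains B K' where "0 < B"
    and "\<And>k. K' \<le> k \<Longrightarrow> E k \<le> B * real (k + 2) powr (- (1 / (2 * \<theta> - 1)))"
proof -
  define q where "q = 1 / (2 * \<theta> - 1)"
  define c' where "c' = c / C\<^sup>2"
  have q: "0 < q" using assms by (simp add: q_def)
  have c': "0 < c'" using c_pos C_pos by (simp add: c'_def)
  have q1: "q * (2 * \<theta> - 1) = 1" using assms by (simp add: q_def)
  have q_exp: "- q * (2 * \<theta>) = - q - 1" using q1 by (simp add: algebra_simps)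
  \<comment> \<open>the first term makes the induction step work, the second one covers its start\<close>
  define B where "B = (q * 2 powr (q + 1) / c') powr q + (E K + 1) * real (K + 2) powr q"
  have B0: "(q * 2 powr (q + 1) / c') powr q \<le> B" "(E K + 1) * real (K + 2) powr q \<le> B"
    using E_nonneg[of K] by (auto simp: B_def)
  have B: "0 < B" 
    using E_nonneg[of K] by (auto simp: B_def intro!: add_nonneg_pos)
  have "q * 2 powr (q + 1) / c' = ((q * 2 powr (q + 1) / c') powr q) powr (2 * \<theta> - 1)"
    using q q1 c' by (simp add: powr_powr)
  also have "\<dots> \<le> B powr (2 * \<theta> - 1)"
    using B0 assms by (intro powr_mono2) auto
  finally have BB: "q * 2 powr (q + 1) \<le> c' * B powr (2 * \<theta> - 1)"
    using c' by (simp add: field_simps)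
  have "E k \<le> B * real (k + 2) powr (- q)" if "K \<le> k" for k
    using that
  proof (induction k rule: dec_induct)
    case base
    have "E K \<le> E K + 1" by simp
    also have "\<dots> = (E K + 1) * real (K + 2) powr q * real (K + 2) powr (- q)"
      by (simp add: powr_minus)
    also have "\<dots> \<le> B * real (K + 2) powr (- q)"
      using B0 by (intro mult_right_mono) auto
    finally show ?case .
  next
    case (step k)
    define x where "x = real (k + 2)"
    have x: "2 \<le> x" by (simp add: x_def)
    show ?case
    proof (rule ccontr)
      let ?e = "B * (x + 1) powr (- q)"
      assume "\<not> ?case"
      then have big: "?e < E (Suc k)" by (simp add: x_def algebra_simps)
      have e0: "0 \<le> ?e" using B by simp
      have "?e powr (2 * \<theta>) = B powr (2 * \<theta> - 1) * B * (x + 1) powr (- q - 1)"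
      proof -
        have "?e powr (2 * \<theta>) = B powr (2 * \<theta>) * (x + 1) powr (- q - 1)"
          using B x by (simp only: powr_mult powr_powr q_exp)
        also have "B powr (2 * \<theta>) = B powr (2 * \<theta> - 1) * B"
          using B by (simp add: powr_diff)
        finally show ?thesis .
      qed
      then have "q * 2 powr (q + 1) * B * (x + 1) powr (- q - 1) \<le> c' * ?e powr (2 * \<theta>)"
        using mult_right_mono[OF BB, of "B * (x + 1) powr (- q - 1)"] B by (simp add: mult_ac)
      also have "\<dots> \<le> c' * E (Suc k) powr (2 * \<theta>)"
        using big e0 c' assms by (intro mult_left_mono powr_mono2) auto
      finally have upper: "?e + q * 2 powr (q + 1) * B * (x + 1) powr (- q - 1) < E k"
        using E_recursion[of k] big step by (simp add: c'_def)
      \<comment> \<open>mean value theorem for the power function\<close>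
      have "\<exists>y. x < y \<and> y < x + 1 \<and>
          (x + 1) powr (- q) - x powr (- q) = (x + 1 - x) * (- q * y powr (- q - 1))"
      proof (rule MVT2)
        show "((\<lambda>w. w powr (- q)) has_real_derivative - q * y powr (- q - 1)) (at y)"
          if "x \<le> y" for y
          using x that by (intro derivative_eq_intros | simp)+
      qed simp
      then obtain y where y: "x < y" "x powr (- q) - (x + 1) powr (- q) = q * y powr (- q - 1)"
        by auto
      have "y powr (- q - 1) \<le> ((x + 1) / 2) powr (- q - 1)"
        using x y q by (intro powr_mono2') auto
      also have "\<dots> = 2 powr (q + 1) * (x + 1) powr (- q - 1)"
        using x by (simp add: powr_divide powr_minus divide_simps powr_diff powr_add)
      finally have "q * y powr (- q - 1) \<le> q * (2 powr (q + 1) * (x + 1) powr (- q - 1))"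
        using q by (intro mult_left_mono) auto
      then have "x powr (- q) \<le> (x + 1) powr (- q) + q * (2 powr (q + 1) * (x + 1) powr (- q - 1))"
        using y by linarith
      then have "B * x powr (- q) \<le> B * ((x + 1) powr (- q) + q * (2 powr (q + 1) * (x + 1) powr (- q - 1)))"
        using B by (intro mult_left_mono) auto
      also have "\<dots> = ?e + q * 2 powr (q + 1) * B * (x + 1) powr (- q - 1)"
        by (simp add: distrib_left mult_ac)
      finally have "B * x powr (- q) \<le> ?e + q * 2 powr (q + 1) * B * (x + 1) powr (- q - 1)" .
      then show False using upper step by (simp add: x_def)
    qed
  qed
  then show ?thesis using B that unfolding q_def by blast
qed

end

lemma dist_limit_le_path_length:
  fixes x :: "nat \<Rightarrow> 'v::real_normed_vector" and A :: "nat \<Rightarrow> real"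
  assumes "x \<longlonglongrightarrow> l" and "\<And>i. norm (x (Suc i) - x i) \<le> A i" and "\<And>n. sum A {k..<n} \<le> R"
  shows "norm (x k - l) \<le> R"
proof (rule LIMSEQ_le_const2)
  show "(\<lambda>n. norm (x k - x n)) \<longlonglongrightarrow> norm (x k - l)"
    using assms(1) by (intro tendsto_intros)
  have "norm (x k - x n) \<le> R" if "k \<le> n" for n
  proof -
    have "norm (x k - x n) = norm (\<Sum>i = k..<n. x (Suc i) - x i)"
      using that by (simp add: sum_Suc_diff' norm_minus_commute)
    also have "\<dots> \<le> sum A {k..<n}" using assms(2) by (intro sum_norm_le) auto
    also have "\<dots> \<le> R" by (rule assms(3))
    finally show ?thesis .
  qed
  then show "\<exists>N. \<forall>n\<ge>N. norm (x k - x n) \<le> R" by blast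
qed

section \<open>Inner product estimates\<close>

lemma norm_add_sq:
  fixes x y :: "'a::real_inner"
  shows "(norm (x + y))\<^sup>2 = (norm x)\<^sup>2 + 2 * (x \<bullet> y) + (norm y)\<^sup>2"
  by (simp add: power2_norm_eq_inner inner_add_left inner_add_right inner_commute)

lemma norm_diff_sq:
  fixes x y :: "'a::real_inner"
  shows "(norm (x - y))\<^sup>2 = (norm x)\<^sup>2 - 2 * (x \<bullet> y) + (norm y)\<^sup>2"
  by (simp add: power2_norm_eq_inner inner_diff_left inner_diff_right inner_commute)

lemma norm_convex_comb_sq:
  fixes x y :: "'a::real_inner"
  assumes "0 \<le> t" "t \<le> 1"
  shows "(norm ((1 - t) *\<^sub>R x + t *\<^sub>R y))\<^sup>2 \<le> (1 - t) * (norm x)\<^sup>2 + t * (norm y)\<^sup>2"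
proof -
  have "(1 - t) * (norm x)\<^sup>2 + t * (norm y)\<^sup>2 - (norm ((1 - t) *\<^sub>R x + t *\<^sub>R y))\<^sup>2
      = t * (1 - t) * (norm (x - y))\<^sup>2"
    by (simp add: power2_norm_eq_inner inner_simps inner_commute algebra_simps)
  moreover have "0 \<le> t * (1 - t) * (norm (x - y))\<^sup>2"
    using assms by simp
  ultimately show ?thesis by linarith
qed

lemma norm_sum_sq_le:
  fixes x y :: "'a::real_inner"
  shows "(norm (x + y))\<^sup>2 \<le> 2 * (norm x)\<^sup>2 + 2 * (norm y)\<^sup>2"
proof -
  have "(norm (x + y))\<^sup>2 + (norm (x - y))\<^sup>2 = 2 * (norm x)\<^sup>2 + 2 * (norm y)\<^sup>2"
    by (simp add: norm_add_sq norm_diff_sq)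
  then show ?thesis using zero_le_power2[of "norm (x - y)"] by linarith
qed

lemma inner_bound:
  fixes x y :: "'c::real_inner"
  assumes "norm x \<le> n" "norm y \<le> k * n" "0 \<le> k"
  shows "- (k * n\<^sup>2) \<le> x \<bullet> y"
proof -
  have "\<bar>x \<bullet> y\<bar> \<le> norm x * norm y" by (rule Cauchy_Schwarz_ineq2)
  also have "\<dots> \<le> n * (k * n)"
    using assms order_trans[OF norm_ge_zero assms(1)] by (intro mult_mono) auto
  finally show ?thesis by (simp add: power2_eq_square mult_ac)
qed

section \<open>Proximal points and limiting subdifferentials\<close>

lemma prox_finite:
  fixes h :: "'a::real_inner \<Rightarrow> ereal"
  assumes "y \<in> prox \<alpha> h x0" and "\<And>x. h x \<noteq> -\<infinity>" and "h x1 < \<infinity>"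
  shows "\<bar>h y\<bar> \<noteq> \<infinity>"
proof
  assume "\<bar>h y\<bar> = \<infinity>"
  then have "h y = \<infinity>" using assms(2)[of y] by (cases "h y") auto
  moreover have "h x1 + ereal (1 / (2 * \<alpha>) * (norm (x1 - x0))\<^sup>2) < \<infinity>"
    using assms(3) by (cases "h x1") auto
  ultimately show False
    using assms(1) unfolding prox_def is_arg_min_def by auto
qed

text \<open>
  For \<open>\<alpha> > 0\<close>, a proximal point \<open>y\<close> of \<open>h\<close> at \<open>x0\<close> carries a concave quadratic minorant of \<open>h\<close> touching at \<open>y\<close>,
  with slope \<open>(x0 - y) / \<alpha>\<close>. It is used twice: as the descent estimate of a proximal step and as
  the source of subgradients.
\<close>

lemma prox_minorant:
  fixes h :: "'a::real_inner \<Rightarrow> ereal"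
  assumes "y \<in> prox \<alpha> h x0" and "h y = ereal r" and "\<And>x. h x \<noteq> -\<infinity>"
  shows "ereal (r + (1 / \<alpha>) *\<^sub>R (x0 - y) \<bullet> (x - y) - 1 / (2 * \<alpha>) * (norm (x - y))\<^sup>2) \<le> h x"
proof (cases "h x")
  case (real s)
  have "\<not> h x + ereal (1 / (2 * \<alpha>) * (norm (x - x0))\<^sup>2) < h y + ereal (1 / (2 * \<alpha>) * (norm (y - x0))\<^sup>2)"
    using assms(1) unfolding prox_def is_arg_min_def by auto
  then have "r + 1 / (2 * \<alpha>) * (norm (y - x0))\<^sup>2 \<le> s + 1 / (2 * \<alpha>) * (norm (x - x0))\<^sup>2"
    using real assms(2) by simp
  moreover have "(norm (x - x0))\<^sup>2 = (norm (x - y))\<^sup>2 - 2 * ((x0 - y) \<bullet> (x - y)) + (norm (y - x0))\<^sup>2"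
    by (simp add: power2_norm_eq_inner inner_simps inner_commute algebra_simps)
  ultimately have "r + 1 / (2 * \<alpha>) * (2 * ((x0 - y) \<bullet> (x - y))) - 1 / (2 * \<alpha>) * (norm (x - y))\<^sup>2 \<le> s"
    by (simp only: right_diff_distrib distrib_left)
  then show ?thesis using real by simp
qed (use assms(3)[of x] in auto)

lemma frechet_subdiff_of_quadratic_minorant:
  fixes \<psi> :: "'a::euclidean_space \<Rightarrow> ereal"
  assumes "\<psi> x = ereal r" and minorant: "\<And>y. ereal (r + d \<bullet> (y - x) - K * (norm (y - x))\<^sup>2) \<le> \<psi> y"
  shows "d \<in> frechet_subdiff \<psi> x"
proof -
  let ?q = "\<lambda>y. (\<psi> y - \<psi> x - ereal (d \<bullet> (y - x))) / ereal (norm (y - x))"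
  have bound: "ereal (- K * norm (y - x)) \<le> ?q y" if "y \<noteq> x" for y
  proof -
    have n: "0 < norm (y - x)" using that by simp
    show ?thesis
    proof (cases "\<psi> y")
      case (real s)
      then have "- K * (norm (y - x))\<^sup>2 \<le> s - r - d \<bullet> (y - x)"
        using minorant[of y] by simp
      then have "- K * norm (y - x) \<le> (s - r - d \<bullet> (y - x)) / norm (y - x)"
        using n by (simp add: field_simps power2_eq_square)
      then show ?thesis using real assms(1) n by simp
    next
      case PInf
      then show ?thesis using assms(1) n by simp
    next
      case MInf
      then show ?thesis using minorant[of y] by simp
    qed
  qed
  have "((\<lambda>y. - K * norm (y - x)) \<longlongrightarrow> - K * norm (x - x)) (at x)"
    by (intro tendsto_intros)
  then have lim: "((\<lambda>y. ereal (- K * norm (y - x))) \<longlongrightarrow> 0) (at x)"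
    by (simp add: zero_ereal_def)
  have "0 \<le> Liminf (at x) ?q"
  proof (subst le_Liminf_iff, intro allI impI)
    fix e :: ereal assume "e < 0"
    then have "eventually (\<lambda>y. e < ereal (- K * norm (y - x))) (at x)"
      using lim by (rule order_tendstoD(1)[rotated])
    moreover have "eventually (\<lambda>y. y \<noteq> x) (at x)" by (simp add: eventually_at_filter)
    ultimately show "eventually (\<lambda>y. e < ?q y) (at x)"
      by eventually_elim (use bound in force)
  qed
  then show ?thesis using assms(1) by (simp add: frechet_subdiff_def edom_def)
qed

lemma frechet_subset_limiting:
  assumes "d \<in> frechet_subdiff \<psi> x"
  shows "d \<in> limiting_subdiff \<psi> x"
proof -
  have "x \<in> edom \<psi>" using assms by (simp add: frechet_subdiff_def)
  then show ?thesis unfolding limiting_subdiff_def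
    using assms by (intro CollectI conjI exI[of _ "\<lambda>_. x"] exI[of _ "\<lambda>_. d"]) auto
qed

lemma lower_semicontinuous_eventually:
  fixes \<psi> :: "'a::topological_space \<Rightarrow> ereal"
  assumes "lower_semicontinuous \<psi>" "(X \<longlongrightarrow> x) F" "e < \<psi> x"
  shows "eventually (\<lambda>k. e < \<psi> (X k)) F"
proof -
  have "e < Liminf (at x) \<psi>"
    using assms(1,3) unfolding lower_semicontinuous_def by (meson less_le_trans)
  then have "eventually (\<lambda>y. e < \<psi> y) (at x)"
    by (rule less_LiminfD)
  then have "eventually (\<lambda>y. e < \<psi> y) (nhds x)"
    using assms(3) by (auto simp: eventually_at_filter elim: eventually_mono)
  then show ?thesis using assms(2) by (rule eventually_compose_filterlim)
qed

section \<open>Quadratic coupling functions\<close>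

text \<open>
  The quadratic form with Hessian \<open>[[a, b], [b', c]]\<close> on a product of two Euclidean spaces; the
  three constants bound the operator norms of \<open>a\<close>, \<open>c\<close> and \<open>b\<close>, and \<open>b'\<close> is the adjoint of \<open>b\<close>.
\<close>

locale quadratic_coupling =
  fixes a :: "'w::euclidean_space \<Rightarrow> 'w" and b :: "'p::euclidean_space \<Rightarrow> 'w"
    and b' :: "'w \<Rightarrow> 'p" and c :: "'p \<Rightarrow> 'p" and \<kappa>\<^sub>1 \<kappa>\<^sub>2 \<kappa>\<^sub>3 :: real
  assumes lin: "linear a" "linear b" "linear b'" "linear c"
    and a_sym: "x \<bullet> a y = a x \<bullet> y" and c_sym: "p \<bullet> c q = c p \<bullet> q"
    and b_adj: "x \<bullet> b p = b' x \<bullet> p"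
    and a_norm: "norm (a x) \<le> \<kappa>\<^sub>1 * norm x"
    and c_norm: "norm (c p) \<le> \<kappa>\<^sub>2 * norm p"
    and b_norm: "norm (b p) \<le> \<kappa>\<^sub>3 * norm p"
    and \<kappa>_nonneg: "0 \<le> \<kappa>\<^sub>1" "0 \<le> \<kappa>\<^sub>2" "0 \<le> \<kappa>\<^sub>3"
begin

definition H :: "'w \<Rightarrow> 'p \<Rightarrow> real" where
  "H x p = (x \<bullet> a x) / 2 + x \<bullet> b p + (p \<bullet> c p) / 2"

text \<open>
  The partial gradients of \<open>H\<close>.
\<close>

definition GW :: "'w \<Rightarrow> 'p \<Rightarrow> 'w" where
  "GW x p = a x + b p"

definition GP :: "'w \<Rightarrow> 'p \<Rightarrow> 'p" where
  "GP x p = b' x + c p"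

lemmas lin_simps =
  linear_add[OF lin(1)] linear_add[OF lin(2)] linear_add[OF lin(3)] linear_add[OF lin(4)]
  linear_diff[OF lin(1)] linear_diff[OF lin(2)] linear_diff[OF lin(3)] linear_diff[OF lin(4)]
  linear_0[OF lin(1)] linear_0[OF lin(2)] linear_0[OF lin(3)] linear_0[OF lin(4)]

lemma H_expand: "H (x + dx) (p + dp) = H x p + GW x p \<bullet> dx + GP x p \<bullet> dp + H dx dp"
proof -
  have "a x \<bullet> dx = x \<bullet> a dx" "c p \<bullet> dp = p \<bullet> c dp" "b' x \<bullet> dp = x \<bullet> b dp"
    by (simp_all add: a_sym c_sym b_adj)
  moreover have "dx \<bullet> a x = x \<bullet> a dx" "dp \<bullet> c p = p \<bullet> c dp"
    by (metis a_sym inner_commute) (metis c_sym inner_commute)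
  ultimately show ?thesis
    by (simp add: H_def GW_def GP_def lin_simps inner_add_left inner_add_right
        inner_commute[of dx] field_simps)
qed

lemma H_x0: "H x 0 \<le> \<kappa>\<^sub>1 / 2 * (norm x)\<^sup>2"
proof -
  have "x \<bullet> a x \<le> norm x * norm (a x)" by (rule norm_cauchy_schwarz)
  also have "\<dots> \<le> norm x * (\<kappa>\<^sub>1 * norm x)" by (intro mult_left_mono a_norm) auto
  finally show ?thesis by (simp add: H_def lin_simps power2_eq_square mult_ac)
qed

lemma H_0p: "H 0 p \<le> \<kappa>\<^sub>2 / 2 * (norm p)\<^sup>2"
proof -
  have "p \<bullet> c p \<le> norm p * norm (c p)" by (rule norm_cauchy_schwarz)
  also have "\<dots> \<le> norm p * (\<kappa>\<^sub>2 * norm p)" by (intro mult_left_mono c_norm) auto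
  finally show ?thesis by (simp add: H_def lin_simps power2_eq_square mult_ac)
qed

lemma H_lower:
  assumes "norm x \<le> n" "norm p \<le> n"
  shows "- ((\<kappa>\<^sub>1 + \<kappa>\<^sub>2 + \<kappa>\<^sub>3) * n\<^sup>2) \<le> H x p"
proof -
  have "norm (a x) \<le> \<kappa>\<^sub>1 * n" "norm (b p) \<le> \<kappa>\<^sub>3 * n" "norm (c p) \<le> \<kappa>\<^sub>2 * n"
    using a_norm[of x] b_norm[of p] c_norm[of p] assms \<kappa>_nonneg
    by (meson mult_left_mono order_trans)+
  then have "- (\<kappa>\<^sub>1 * n\<^sup>2) \<le> x \<bullet> a x" "- (\<kappa>\<^sub>3 * n\<^sup>2) \<le> x \<bullet> b p" "- (\<kappa>\<^sub>2 * n\<^sup>2) \<le> p \<bullet> c p"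
    using assms \<kappa>_nonneg by (auto intro: inner_bound)
  moreover have "0 \<le> \<kappa>\<^sub>1 * n\<^sup>2" "0 \<le> \<kappa>\<^sub>2 * n\<^sup>2" using \<kappa>_nonneg by auto
  ultimately show ?thesis by (simp add: H_def algebra_simps)
qed

lemma tendsto_lin:
  assumes "(h \<longlongrightarrow> l) F" "(h' \<longlongrightarrow> l') F"
  shows "((\<lambda>x. a (h x)) \<longlongrightarrow> a l) F" "((\<lambda>x. b' (h x)) \<longlongrightarrow> b' l) F"
    "((\<lambda>x. b (h' x)) \<longlongrightarrow> b l') F" "((\<lambda>x. c (h' x)) \<longlongrightarrow> c l') F"
  using lin[unfolded linear_conv_bounded_linear] assms by (auto dest: bounded_linear.tendsto)

lemma tendsto_H:
  assumes "(h \<longlongrightarrow> l) F" "(h' \<longlongrightarrow> l') F"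
  shows "((\<lambda>x. H (h x) (h' x)) \<longlongrightarrow> H l l') F"
  unfolding H_def by (intro tendsto_intros tendsto_lin assms) auto

lemma gradient_H:
  "gradient (\<lambda>x. H x p) x0 = GW x0 p" "gradient (\<lambda>p. H x p) p0 = GP x p0"
proof -
  have 1: "GDERIV (\<lambda>x. H x p) x0 :> GW x0 p"
  proof -
    have "((\<lambda>x. x \<bullet> a x) has_derivative (\<lambda>d. x0 \<bullet> a d + d \<bullet> a x0)) (at x0)"
      by (intro has_derivative_inner has_derivative_ident linear_imp_has_derivative lin)
    then have "((\<lambda>x. H x p) has_derivative (\<lambda>d. (x0 \<bullet> a d + d \<bullet> a x0) / 2 + d \<bullet> b p + 0)) (at x0)"
      unfolding H_def divide_inverse
      by (intro has_derivative_add has_derivative_mult_left has_derivative_inner_left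
          has_derivative_ident has_derivative_const)
    moreover have "(\<lambda>d. (x0 \<bullet> a d + d \<bullet> a x0) / 2 + d \<bullet> b p + 0) = (\<lambda>d. d \<bullet> GW x0 p)"
    proof
      fix d
      have "x0 \<bullet> a d = d \<bullet> a x0" by (metis a_sym inner_commute)
      then show "(x0 \<bullet> a d + d \<bullet> a x0) / 2 + d \<bullet> b p + 0 = d \<bullet> GW x0 p"
        by (simp add: GW_def inner_add_right)
    qed
    ultimately show ?thesis by (simp add: gderiv_def)
  qed
  have 2: "GDERIV (\<lambda>p. H x p) p0 :> GP x p0"
  proof -
    have "((\<lambda>p. p \<bullet> c p) has_derivative (\<lambda>d. p0 \<bullet> c d + d \<bullet> c p0)) (at p0)"
      by (intro has_derivative_inner has_derivative_ident linear_imp_has_derivative lin)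
    then have "((\<lambda>p. H x p) has_derivative (\<lambda>d. 0 + x \<bullet> b d + (p0 \<bullet> c d + d \<bullet> c p0) / 2)) (at p0)"
      unfolding H_def divide_inverse
      by (intro has_derivative_add has_derivative_mult_left has_derivative_inner_right
          linear_imp_has_derivative lin has_derivative_const)
    moreover have "(\<lambda>d. 0 + x \<bullet> b d + (p0 \<bullet> c d + d \<bullet> c p0) / 2) = (\<lambda>d. d \<bullet> GP x p0)"
    proof
      fix d
      have "p0 \<bullet> c d = d \<bullet> c p0" by (metis c_sym inner_commute)
      moreover have "x \<bullet> b d = d \<bullet> b' x" by (metis b_adj inner_commute)
      ultimately show "0 + x \<bullet> b d + (p0 \<bullet> c d + d \<bullet> c p0) / 2 = d \<bullet> GP x p0"
        by (simp add: GP_def inner_add_right)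
    qed
    ultimately show ?thesis by (simp add: gderiv_def)
  qed
  have uniq: "D = D'" if "GDERIV h y :> D" "GDERIV h y :> D'" for h :: "'v::real_inner \<Rightarrow> real" and y D D'
  proof -
    have "(\<lambda>d. d \<bullet> D) = (\<lambda>d. d \<bullet> D')"
      using that unfolding gderiv_def by (rule has_derivative_unique)
    then have "(D - D') \<bullet> D = (D - D') \<bullet> D'" by metis
    then have "(D - D') \<bullet> (D - D') = 0" by (simp add: inner_diff_right)
    then show ?thesis by simp
  qed
  show "gradient (\<lambda>x. H x p) x0 = GW x0 p" unfolding gradient_def
    using 1 uniq by blast
  show "gradient (\<lambda>p. H x p) p0 = GP x p0" unfolding gradient_def
    using 2 uniq by blast
qed

end

section \<open>The proximal alternating linearized method with multipliers\<close>

text \<open>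
  A convergent run of the method for \<open>f z + g P + H W P\<close> subject to \<open>W = z\<close>, with a quadratic
  coupling \<open>H\<close> and the gradients written out. The functions \<open>f\<close> and \<open>g\<close> are only required to avoid
  the value \<open>-\<infinity>\<close>; lower semicontinuity and properness enter through the assumption on \<open>\<Psi>\<close>. The
  assumption \<open>\<tau>_margin\<close> is a quadratic inequality in \<open>\<tau>\<close>; it says that \<open>\<tau>\<close> lies strictly between
  two explicit roots.
\<close>

locale palm = quadratic_coupling a b b' c \<kappa>\<^sub>1 \<kappa>\<^sub>2 \<kappa>\<^sub>3
  for a :: "'w::euclidean_space \<Rightarrow> 'w" and b :: "'p::euclidean_space \<Rightarrow> 'w"
    and b' :: "'w \<Rightarrow> 'p" and c :: "'p \<Rightarrow> 'p" and \<kappa>\<^sub>1 \<kappa>\<^sub>2 \<kappa>\<^sub>3 :: real +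
  fixes f :: "'w \<Rightarrow> ereal" and g :: "'p \<Rightarrow> ereal" and \<mu> \<beta> \<tau> \<sigma> \<theta> :: real
    and W z u :: "nat \<Rightarrow> 'w" and P :: "nat \<Rightarrow> 'p"
    and Wstar zstar ustar :: 'w and Pstar :: 'p
  assumes f_ninf: "f x \<noteq> -\<infinity>" and g_ninf: "g p \<noteq> -\<infinity>"
    and \<sigma>_pos: "0 < \<sigma>" and \<sigma>_less: "\<sigma> < 1" and \<beta>_pos: "0 < \<beta>"
    and \<mu>_large: "\<kappa>\<^sub>2 + 16 * \<kappa>\<^sub>3\<^sup>2 / (\<sigma> * \<beta>) < \<mu>"
    and \<tau>_large: "\<beta> / 2 \<le> \<tau>"
    and \<tau>_margin: "(\<beta> + \<kappa>\<^sub>1) / 2 + 8 * \<kappa>\<^sub>1\<^sup>2 / (\<sigma> * \<beta>) + 16 * \<kappa>\<^sub>1 * \<tau> / \<beta> + 12 * \<sigma> * \<tau>\<^sup>2 / \<beta> < \<tau>"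
    and P_step: "P (Suc k) \<in> prox (inverse \<mu>) g (P k - inverse \<mu> *\<^sub>R GP (W k) (P k))"
    and z_step: "z (Suc k) \<in> prox (inverse \<beta>) f (W k + inverse \<beta> *\<^sub>R u k)"
    and W_step: "W (Suc k) = W k - inverse \<tau> *\<^sub>R (GW (W k) (P (Suc k)) + u k + \<beta> *\<^sub>R (W k - z (Suc k)))"
    and u_step: "u (Suc k) = u k + (\<sigma> * \<beta>) *\<^sub>R (W (Suc k) - z (Suc k))"
    and lims: "W \<longlonglongrightarrow> Wstar" "P \<longlonglongrightarrow> Pstar" "z \<longlonglongrightarrow> zstar" "u \<longlonglongrightarrow> ustar"
    and \<theta>_pos: "0 < \<theta>"
    and loj: "lojasiewicz (Psi f g H \<sigma> \<tau> \<beta> \<kappa>\<^sub>1) \<theta>"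
begin

abbreviation \<psi> :: "'w \<times> 'p \<times> 'w \<times> 'w \<times> 'w \<times> 'w \<Rightarrow> ereal" where
  "\<psi> \<equiv> Psi f g H \<sigma> \<tau> \<beta> \<kappa>\<^sub>1"

text \<open>
  The constants of the regularized augmented Lagrangian \<open>\<psi>\<close>.
\<close>

definition s :: real where "s = \<sigma> * (\<tau> - \<beta>)"
definition C0 :: real where "C0 = 4 * (1 - \<sigma>) / (\<sigma>\<^sup>2 * \<beta>)"
definition C1 :: real where "C1 = 8 * (\<sigma> * \<tau> + \<kappa>\<^sub>1)\<^sup>2 / (\<sigma> * \<beta>)"

text \<open>
  The quadratic part of \<open>\<psi>\<close>, so that \<open>\<psi> (x, p, y, v, x', v') = f y + g p + S (x, p, y, v, x', v')\<close>,
  and below it its gradient \<open>DS\<close>.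
\<close>

definition S :: "'w \<times> 'p \<times> 'w \<times> 'w \<times> 'w \<times> 'w \<Rightarrow> real" where
  "S = (\<lambda>(x, p, y, v, x', v'). H x p + v \<bullet> (x - y) + \<beta> / 2 * (norm (x - y))\<^sup>2
     + C0 * (norm ((v - v') + s *\<^sub>R (x - x')))\<^sup>2 + C1 * (norm (x - x'))\<^sup>2)"

definition DS :: "'w \<times> 'p \<times> 'w \<times> 'w \<times> 'w \<times> 'w \<Rightarrow> 'w \<times> 'p \<times> 'w \<times> 'w \<times> 'w \<times> 'w" where
  "DS = (\<lambda>(x, p, y, v, x', v'). let e = (v - v') + s *\<^sub>R (x - x') in
     (GW x p + v + \<beta> *\<^sub>R (x - y) + (2 * C0 * s) *\<^sub>R e + (2 * C1) *\<^sub>R (x - x'),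
      GP x p,
      - v - \<beta> *\<^sub>R (x - y),
      (x - y) + (2 * C0) *\<^sub>R e,
      - (2 * C0 * s) *\<^sub>R e - (2 * C1) *\<^sub>R (x - x'),
      - (2 * C0) *\<^sub>R e))"

lemma \<tau>_pos: "0 < \<tau>" and \<mu>_pos: "0 < \<mu>"
proof -
  show "0 < \<tau>" using \<beta>_pos \<tau>_large by simp
  have "0 \<le> 16 * \<kappa>\<^sub>3\<^sup>2 / (\<sigma> * \<beta>)" using \<sigma>_pos \<beta>_pos by simp
  then show "0 < \<mu>" using \<mu>_large \<kappa>_nonneg by linarith
qed

lemma C_nonneg: "0 \<le> C0" "0 \<le> C1"
  using \<sigma>_pos \<sigma>_less \<beta>_pos by (auto simp: C0_def C1_def)

lemma \<psi>_eq: "\<psi> (x, p, y, v, x', v') = f y + g p + ereal (S (x, p, y, v, x', v'))"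
  by (simp add: Psi_def S_def C0_def C1_def s_def Let_def)

text \<open>
  A quadratic form without terms of lower order coincides with its own second-order remainder.
\<close>

lemma S_expand: "S (X + D) = S X + DS X \<bullet> D + S D"
proof -
  obtain x p y v x' v' where X: "X = (x, p, y, v, x', v')" by (cases X)
  obtain dx dp dy dv dx' dv' where D: "D = (dx, dp, dy, dv, dx', dv')" by (cases D)
  define e where "e = (v - v') + s *\<^sub>R (x - x')"
  define de where "de = (dv - dv') + s *\<^sub>R (dx - dx')"
  have 1: "(v + dv) \<bullet> ((x + dx) - (y + dy))
      = v \<bullet> (x - y) + v \<bullet> (dx - dy) + dv \<bullet> (x - y) + dv \<bullet> (dx - dy)"
    by (simp add: inner_simps)
  have 2: "(norm ((x + dx) - (y + dy)))\<^sup>2 = (norm (x - y))\<^sup>2 + 2 * ((x - y) \<bullet> (dx - dy)) + (norm (dx - dy))\<^sup>2"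
    using norm_add_sq[of "x - y" "dx - dy"] by (simp add: algebra_simps)
  have 3: "(norm ((x + dx) - (x' + dx')))\<^sup>2 = (norm (x - x'))\<^sup>2 + 2 * ((x - x') \<bullet> (dx - dx')) + (norm (dx - dx'))\<^sup>2"
    using norm_add_sq[of "x - x'" "dx - dx'"] by (simp add: algebra_simps)
  have "((v + dv) - (v' + dv')) + s *\<^sub>R ((x + dx) - (x' + dx')) = e + de"
    by (simp add: e_def de_def algebra_simps)
  then have 4: "(norm (((v + dv) - (v' + dv')) + s *\<^sub>R ((x + dx) - (x' + dx'))))\<^sup>2
      = (norm e)\<^sup>2 + 2 * (e \<bullet> de) + (norm de)\<^sup>2"
    by (simp only: norm_add_sq)
  have 5: "e \<bullet> de = e \<bullet> (dv - dv') + s * (e \<bullet> (dx - dx'))"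
    by (simp add: de_def inner_simps)
  have "S (X + D) = (H x p + GW x p \<bullet> dx + GP x p \<bullet> dp + H dx dp)
      + (v \<bullet> (x - y) + v \<bullet> (dx - dy) + dv \<bullet> (x - y) + dv \<bullet> (dx - dy))
      + \<beta> / 2 * ((norm (x - y))\<^sup>2 + 2 * ((x - y) \<bullet> (dx - dy)) + (norm (dx - dy))\<^sup>2)
      + C0 * ((norm e)\<^sup>2 + 2 * (e \<bullet> (dv - dv') + s * (e \<bullet> (dx - dx'))) + (norm de)\<^sup>2)
      + C1 * ((norm (x - x'))\<^sup>2 + 2 * ((x - x') \<bullet> (dx - dx')) + (norm (dx - dx'))\<^sup>2)"
    unfolding X D S_def prod.case add_Pair H_expand 1 2 3 4 5 ..
  also have "\<dots> = S X + DS X \<bullet> D + S D"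
    unfolding X D S_def DS_def prod.case Let_def inner_Pair e_def[symmetric] de_def[symmetric]
    by (simp add: inner_add_left inner_diff_left inner_diff_right inner_commute[of dv] algebra_simps)
  finally show ?thesis .
qed

lemma S_lower: "- ((\<kappa>\<^sub>1 + \<kappa>\<^sub>2 + \<kappa>\<^sub>3 + 2) * (norm D)\<^sup>2) \<le> S D"
proof -
  obtain x p y v x' v' where D: "D = (x, p, y, v, x', v')" by (cases D)
  define n where "n = norm D"
  have n: "norm x \<le> n" "norm p \<le> n" "norm y \<le> n" "norm v \<le> n"
    unfolding n_def D by (meson norm_fst_le norm_snd_le order_trans)+
  have "norm (x - y) \<le> 2 * n" using norm_triangle_ineq4[of x y] n by linarith
  then have "- (2 * n\<^sup>2) \<le> v \<bullet> (x - y)" using n by (intro inner_bound) auto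
  moreover have "- ((\<kappa>\<^sub>1 + \<kappa>\<^sub>2 + \<kappa>\<^sub>3) * n\<^sup>2) \<le> H x p" using n by (intro H_lower)
  moreover have "0 \<le> \<beta> / 2 * (norm (x - y))\<^sup>2" "0 \<le> C1 * (norm (x - x'))\<^sup>2"
    "0 \<le> C0 * (norm ((v - v') + s *\<^sub>R (x - x')))\<^sup>2"
    using \<beta>_pos C_nonneg by auto
  ultimately show ?thesis unfolding n_def[symmetric] unfolding D S_def by (simp add: algebra_simps)
qed

lemma domain_nonempty: "\<exists>y p. f y < \<infinity> \<and> g p < \<infinity>"
proof -
  obtain X where X: "\<psi> X < \<infinity>"
    using loj unfolding lojasiewicz_def proper_fun_def edom_def by auto
  obtain x p y v x' v' where "X = (x, p, y, v, x', v')" by (cases X)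
  then have "f y + g p + ereal (S X) < \<infinity>" using X by (simp add: \<psi>_eq)
  then have "f y < \<infinity> \<and> g p < \<infinity>" using f_ninf[of y] g_ninf[of p] by (cases "f y"; cases "g p") auto
  then show ?thesis by blast
qed

text \<open>
  The values of \<open>f\<close> and \<open>g\<close> along the iteration, which are finite. The index is shifted because
  nothing is assumed about the values at the initial point.
\<close>

definition fr :: "nat \<Rightarrow> real" where "fr k = real_of_ereal (f (z (Suc k)))"
definition gr :: "nat \<Rightarrow> real" where "gr k = real_of_ereal (g (P (Suc k)))"

lemma f_fr: "f (z (Suc k)) = ereal (fr k)" and g_gr: "g (P (Suc k)) = ereal (gr k)"
proof -
  obtain y p where "f y < \<infinity>" "g p < \<infinity>" using domain_nonempty by blast
  then have "\<bar>f (z (Suc k))\<bar> \<noteq> \<infinity>" "\<bar>g (P (Suc k))\<bar> \<noteq> \<infinity>"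
    using prox_finite[OF z_step f_ninf] prox_finite[OF P_step g_ninf] by auto
  then show "f (z (Suc k)) = ereal (fr k)" "g (P (Suc k)) = ereal (gr k)"
    by (auto simp: fr_def gr_def ereal_real)
qed

text \<open>
  Subgradients of \<open>g\<close> at \<open>P (Suc k)\<close> and of \<open>f\<close> at \<open>z (Suc k)\<close> furnished by the proximal steps.
\<close>

definition \<xi> :: "nat \<Rightarrow> 'p" where "\<xi> k = \<mu> *\<^sub>R (P k - P (Suc k)) - GP (W k) (P k)"
definition \<zeta> :: "nat \<Rightarrow> 'w" where "\<zeta> k = \<beta> *\<^sub>R (W k - z (Suc k)) + u k"

lemma f_minorant:
  "ereal (fr k + \<zeta> k \<bullet> (y - z (Suc k)) - \<beta> / 2 * (norm (y - z (Suc k)))\<^sup>2) \<le> f y"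
proof -
  have "(1 / inverse \<beta>) *\<^sub>R (W k + inverse \<beta> *\<^sub>R u k - z (Suc k)) = \<zeta> k"
    using \<beta>_pos by (simp add: \<zeta>_def divide_inverse algebra_simps)
  moreover have "1 / (2 * inverse \<beta>) = \<beta> / 2" by (simp add: field_simps)
  ultimately show ?thesis using prox_minorant[OF z_step f_fr f_ninf, of k y] by metis
qed

lemma g_minorant:
  "ereal (gr k + \<xi> k \<bullet> (p - P (Suc k)) - \<mu> / 2 * (norm (p - P (Suc k)))\<^sup>2) \<le> g p"
proof -
  have "(1 / inverse \<mu>) *\<^sub>R (P k - inverse \<mu> *\<^sub>R GP (W k) (P k) - P (Suc k)) = \<xi> k"
    using \<mu>_pos by (simp add: \<xi>_def divide_inverse algebra_simps)
  moreover have "1 / (2 * inverse \<mu>) = \<mu> / 2" by (simp add: field_simps)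
  ultimately show ?thesis using prox_minorant[OF P_step g_gr g_ninf, of k p] by metis
qed

text \<open>
  The point at which \<open>\<psi>\<close> is evaluated: the iterate of index \<open>Suc k\<close> together with the previous
  values of \<open>W\<close> and \<open>u\<close>.
\<close>

definition X :: "nat \<Rightarrow> 'w \<times> 'p \<times> 'w \<times> 'w \<times> 'w \<times> 'w" where
  "X k = (W (Suc k), P (Suc k), z (Suc k), u (Suc k), W k, u k)"

definition Xstar :: "'w \<times> 'p \<times> 'w \<times> 'w \<times> 'w \<times> 'w" where
  "Xstar = (Wstar, Pstar, zstar, ustar, Wstar, ustar)"

text \<open>
  The steps taken from index \<open>k\<close> to \<open>Suc k\<close>. The combination \<open>v\<close> is the vector whose squared norm
  is weighted by \<open>C0\<close> in \<open>\<psi>\<close>.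
\<close>

definition dW :: "nat \<Rightarrow> 'w" where "dW k = W (Suc k) - W k"
definition dP :: "nat \<Rightarrow> 'p" where "dP k = P (Suc k) - P k"
definition du :: "nat \<Rightarrow> 'w" where "du k = u (Suc k) - u k"
definition v :: "nat \<Rightarrow> 'w" where "v k = du k + s *\<^sub>R dW k"

text \<open>
  The length of a step. The step in \<open>z\<close> is not needed, as \<open>z\<close> is determined by \<open>W\<close> and \<open>u\<close>.
\<close>

definition A :: "nat \<Rightarrow> real" where "A k = norm (dW k) + norm (dP k) + norm (du k)"

text \<open>
  The real value of \<open>\<psi>\<close> at \<open>X k\<close>.
\<close>

definition \<psi>r :: "nat \<Rightarrow> real" where "\<psi>r k = fr k + gr k + S (X k)"

lemma \<psi>_X: "\<psi> (X k) = ereal (\<psi>r k)"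
  by (simp add: X_def \<psi>_eq f_fr g_gr \<psi>r_def)

text \<open>
  A subgradient of \<open>\<psi>\<close> at \<open>X k\<close>.
\<close>

definition d :: "nat \<Rightarrow> 'w \<times> 'p \<times> 'w \<times> 'w \<times> 'w \<times> 'w" where
  "d k = DS (X k) + (0, \<xi> k, \<zeta> k, 0, 0, 0)"

lemma d_subgradient: "d k \<in> frechet_subdiff \<psi> (X k)"
proof (rule frechet_subdiff_of_quadratic_minorant[where \<psi> = \<psi> and x = "X k", OF \<psi>_X])
  let ?K = "\<kappa>\<^sub>1 + \<kappa>\<^sub>2 + \<kappa>\<^sub>3 + 2 + \<beta> / 2 + \<mu> / 2"
  fix Y :: "'w \<times> 'p \<times> 'w \<times> 'w \<times> 'w \<times> 'w"
  obtain x p y w x' w' where Y: "Y = (x, p, y, w, x', w')" by (cases Y)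
  define D where "D = Y - X k"
  let ?dp = "p - P (Suc k)" and ?dy = "y - z (Suc k)"
  have D: "D = (x - W (Suc k), ?dp, ?dy, w - u (Suc k), x' - W k, w' - u k)"
    by (simp add: D_def Y X_def)
  have n: "norm ?dp \<le> norm D" "norm ?dy \<le> norm D"
    unfolding D by (meson norm_fst_le norm_snd_le order_trans)+
  have "\<beta> / 2 * (norm ?dy)\<^sup>2 \<le> \<beta> / 2 * (norm D)\<^sup>2" "\<mu> / 2 * (norm ?dp)\<^sup>2 \<le> \<mu> / 2 * (norm D)\<^sup>2"
    using \<beta>_pos \<mu>_pos n by (auto intro!: mult_left_mono power_mono)
  moreover have "S Y = S (X k) + DS (X k) \<bullet> D + S D"
    using S_expand[of "X k" D] by (simp add: D_def)
  moreover have "d k \<bullet> D = DS (X k) \<bullet> D + \<xi> k \<bullet> ?dp + \<zeta> k \<bullet> ?dy"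
    unfolding d_def by (simp add: inner_add_left D)
  ultimately have "\<psi>r k + d k \<bullet> D - ?K * (norm D)\<^sup>2
      \<le> (fr k + \<zeta> k \<bullet> ?dy - \<beta> / 2 * (norm ?dy)\<^sup>2) + (gr k + \<xi> k \<bullet> ?dp - \<mu> / 2 * (norm ?dp)\<^sup>2) + S Y"
    using S_lower[of D] unfolding \<psi>r_def distrib_right by linarith
  then have "ereal (\<psi>r k + d k \<bullet> D - ?K * (norm D)\<^sup>2)
      \<le> ereal (fr k + \<zeta> k \<bullet> ?dy - \<beta> / 2 * (norm ?dy)\<^sup>2) + ereal (gr k + \<xi> k \<bullet> ?dp - \<mu> / 2 * (norm ?dp)\<^sup>2) + ereal (S Y)"
    by simp
  also have "\<dots> \<le> f y + g p + ereal (S Y)"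
    by (intro add_mono f_minorant g_minorant) auto
  also have "\<dots> = \<psi> Y" by (simp add: Y \<psi>_eq)
  finally show "ereal (\<psi>r k + d k \<bullet> (Y - X k) - ?K * (norm (Y - X k))\<^sup>2) \<le> \<psi> Y"
    by (simp only: D_def)
qed

lemma W_step': "GW (W k) (P (Suc k)) + u k + \<beta> *\<^sub>R (W k - z (Suc k)) = - \<tau> *\<^sub>R dW k"
  using \<tau>_pos by (simp add: dW_def W_step[of k])

lemma u_step': "W (Suc k) - z (Suc k) = (1 / (\<sigma> * \<beta>)) *\<^sub>R du k"
  using \<sigma>_pos \<beta>_pos by (simp add: du_def u_step[of k])

lemma d_bound: obtains B where "0 < B" and "\<And>k. norm (d k) \<le> B * A k"
proof -
  \<comment> \<open>the subgradient depends linearly on the last step\<close>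
  define L :: "'w \<times> 'p \<times> 'w \<Rightarrow> 'w \<times> 'p \<times> 'w \<times> 'w \<times> 'w \<times> 'w" where
    "L = (\<lambda>(x, p, w). (a x - \<tau> *\<^sub>R x + w + \<beta> *\<^sub>R x + (2 * C0 * s) *\<^sub>R (w + s *\<^sub>R x) + (2 * C1) *\<^sub>R x,
        b' x + c p - \<mu> *\<^sub>R p,
        - w - \<beta> *\<^sub>R x,
        (1 / (\<sigma> * \<beta>)) *\<^sub>R w + (2 * C0) *\<^sub>R (w + s *\<^sub>R x),
        - (2 * C0 * s) *\<^sub>R (w + s *\<^sub>R x) - (2 * C1) *\<^sub>R x,
        - (2 * C0) *\<^sub>R (w + s *\<^sub>R x)))"
  have "linear L"
    by (rule linearI) (auto simp: L_def lin_simps linear_scale[OF lin(1)] linear_scale[OF lin(3)]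
        linear_scale[OF lin(4)] scaleR_add_right scaleR_diff_right mult.commute)
  then obtain B where B: "0 < B" "\<And>x. norm (L x) \<le> B * norm x"
    using linear_bounded_pos by blast
  have "norm (d k) \<le> B * A k" for k
  proof -
    have "GW (W (Suc k)) (P (Suc k)) + u (Suc k) + \<beta> *\<^sub>R (W (Suc k) - z (Suc k))
        = (GW (W k) (P (Suc k)) + u k + \<beta> *\<^sub>R (W k - z (Suc k))) + a (dW k) + du k + \<beta> *\<^sub>R dW k"
      by (simp add: GW_def dW_def du_def lin_simps algebra_simps)
    then have 1: "GW (W (Suc k)) (P (Suc k)) + u (Suc k) + \<beta> *\<^sub>R (W (Suc k) - z (Suc k))
        = a (dW k) - \<tau> *\<^sub>R dW k + du k + \<beta> *\<^sub>R dW k"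
      unfolding W_step' by simp
    have 2: "GP (W (Suc k)) (P (Suc k)) + \<xi> k = b' (dW k) + c (dP k) - \<mu> *\<^sub>R dP k"
      by (simp add: GP_def \<xi>_def dW_def dP_def lin_simps algebra_simps)
    have 3: "- u (Suc k) - \<beta> *\<^sub>R (W (Suc k) - z (Suc k)) + \<zeta> k = - du k - \<beta> *\<^sub>R dW k"
      by (simp add: \<zeta>_def dW_def du_def algebra_simps)
    have "d k = L (dW k, dP k, du k)"
      unfolding d_def X_def DS_def L_def prod.case Let_def add_Pair dW_def[symmetric] du_def[symmetric]
        1 2 3 unfolding u_step' by simp
    then have "norm (d k) \<le> B * norm (dW k, dP k, du k)" using B by simp
    also have "norm (dW k, dP k, du k) \<le> A k"
      unfolding A_def using norm_Pair_le[of "dW k" "(dP k, du k)"] norm_Pair_le[of "dP k" "du k"] by linarith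
    finally show ?thesis using B by simp
  qed
  then show ?thesis using B that by blast
qed

lemma s_sq: "s\<^sup>2 \<le> (\<sigma> * \<tau>)\<^sup>2" and s_abs: "\<bar>s\<bar> \<le> \<sigma> * \<tau>"
proof -
  have "\<bar>\<tau> - \<beta>\<bar> \<le> \<tau>" using \<tau>_large \<beta>_pos by linarith
  then show "\<bar>s\<bar> \<le> \<sigma> * \<tau>" using \<sigma>_pos by (simp add: s_def abs_mult)
  then show "s\<^sup>2 \<le> (\<sigma> * \<tau>)\<^sup>2" using \<sigma>_pos \<tau>_pos by (simp add: abs_le_square_iff[symmetric])
qed

text \<open>
  The updates of \<open>P\<close>, \<open>z\<close> and \<open>W\<close> decrease the augmented Lagrangian, while the update of the
  multiplier increases it by \<open>1 / (\<sigma> * \<beta>) * (norm (du (Suc k)))\<^sup>2\<close>.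
\<close>

lemma lagrangian_descent:
  defines "L \<equiv> \<lambda>k. fr k + gr k + H (W (Suc k)) (P (Suc k)) + u (Suc k) \<bullet> (W (Suc k) - z (Suc k))
      + \<beta> / 2 * (norm (W (Suc k) - z (Suc k)))\<^sup>2"
  shows "L (Suc k) + (\<mu> - \<kappa>\<^sub>2) / 2 * (norm (dP (Suc k)))\<^sup>2 + (\<tau> - (\<beta> + \<kappa>\<^sub>1) / 2) * (norm (dW (Suc k)))\<^sup>2
    \<le> L k + 1 / (\<sigma> * \<beta>) * (norm (du (Suc k)))\<^sup>2"
proof -
  define x p y w where "x = W (Suc k)" "p = P (Suc k)" "y = z (Suc k)" "w = u (Suc k)"
  define dx dp dw y' where "dx = dW (Suc k)" "dp = dP (Suc k)" "dw = du (Suc k)" "y' = z (Suc (Suc k))"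
  note defs = x_p_y_w_def dx_dp_dw_y'_def
  have next_eqs: "W (Suc (Suc k)) = x + dx" "P (Suc (Suc k)) = p + dp" "u (Suc (Suc k)) = w + dw"
    by (simp_all add: defs dW_def dP_def du_def)
  have P_update: "gr (Suc k) + H x (p + dp) + (\<mu> - \<kappa>\<^sub>2) / 2 * (norm dp)\<^sup>2 \<le> gr k + H x p"
  proof -
    have "gr (Suc k) + \<xi> (Suc k) \<bullet> (- dp) - \<mu> / 2 * (norm (- dp))\<^sup>2 \<le> gr k"
    proof -
      have "g p = ereal (gr k)" "p - P (Suc (Suc k)) = - dp" by (simp_all add: defs g_gr dP_def)
      then show ?thesis using g_minorant[of "Suc k" p] by simp
    qed
    moreover have "\<xi> (Suc k) \<bullet> (- dp) = \<mu> * (norm dp)\<^sup>2 + GP x p \<bullet> dp"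
      unfolding \<xi>_def next_eqs defs(1,2)[symmetric]
      by (simp add: inner_diff_left inner_diff_right power2_norm_eq_inner algebra_simps flip: defs)
    moreover have "H x (p + dp) \<le> H x p + GP x p \<bullet> dp + \<kappa>\<^sub>2 / 2 * (norm dp)\<^sup>2"
      using H_expand[of x 0 p dp] H_0p[of dp] by simp
    ultimately show ?thesis by (simp add: field_simps)
  qed
  have z_update: "fr (Suc k) + w \<bullet> (x - y') + \<beta> / 2 * (norm (x - y'))\<^sup>2
      \<le> fr k + w \<bullet> (x - y) + \<beta> / 2 * (norm (x - y))\<^sup>2"
  proof -
    have "fr (Suc k) + (\<beta> *\<^sub>R (x - y') + w) \<bullet> (y - y') - \<beta> / 2 * (norm (y - y'))\<^sup>2 \<le> fr k"
    proof -
      have "f y = ereal (fr k)" "\<zeta> (Suc k) = \<beta> *\<^sub>R (x - y') + w" "z (Suc (Suc k)) = y'"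
        by (simp_all add: defs f_fr \<zeta>_def)
      then show ?thesis using f_minorant[of "Suc k" y] by simp
    qed
    moreover have "(\<beta> *\<^sub>R (x - y') + w) \<bullet> (y - y') = \<beta> * ((x - y') \<bullet> (y - y')) + w \<bullet> (y - y')"
      by (simp add: inner_add_left)
    moreover have "\<beta> / 2 * (norm (x - y))\<^sup>2
        = \<beta> / 2 * (norm (x - y'))\<^sup>2 - \<beta> * ((x - y') \<bullet> (y - y')) + \<beta> / 2 * (norm (y - y'))\<^sup>2"
    proof -
      have "(norm (x - y))\<^sup>2 = (norm (x - y'))\<^sup>2 - 2 * ((x - y') \<bullet> (y - y')) + (norm (y - y'))\<^sup>2"
        using norm_diff_sq[of "x - y'" "y - y'"] by simp
      then show ?thesis by (simp only: distrib_left right_diff_distrib)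
    qed
    moreover have "w \<bullet> (x - y) = w \<bullet> (x - y') - w \<bullet> (y - y')"
      by (simp add: inner_simps)
    ultimately show ?thesis by linarith
  qed
  have W_update: "H (x + dx) (p + dp) + w \<bullet> (x + dx - y') + \<beta> / 2 * (norm (x + dx - y'))\<^sup>2
      + (\<tau> - (\<beta> + \<kappa>\<^sub>1) / 2) * (norm dx)\<^sup>2
      \<le> H x (p + dp) + w \<bullet> (x - y') + \<beta> / 2 * (norm (x - y'))\<^sup>2"
  proof -
    have "GW x (p + dp) + w + \<beta> *\<^sub>R (x - y') = - \<tau> *\<^sub>R dx"
      using W_step'[of "Suc k"] by (simp add: next_eqs flip: defs)
    then have "GW x (p + dp) \<bullet> dx + w \<bullet> dx + \<beta> * ((x - y') \<bullet> dx) = - \<tau> * (norm dx)\<^sup>2"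
      by (metis inner_add_left inner_scaleR_left power2_norm_eq_inner)
    moreover have "H (x + dx) (p + dp) \<le> H x (p + dp) + GW x (p + dp) \<bullet> dx + \<kappa>\<^sub>1 / 2 * (norm dx)\<^sup>2"
      using H_expand[of x dx "p + dp" 0] H_x0[of dx] by simp
    moreover have "(norm (x + dx - y'))\<^sup>2 = (norm (x - y'))\<^sup>2 + 2 * ((x - y') \<bullet> dx) + (norm dx)\<^sup>2"
      using norm_add_sq[of "x - y'" dx] by (simp add: algebra_simps)
    moreover have "w \<bullet> (x + dx - y') = w \<bullet> (x - y') + w \<bullet> dx"
      by (simp add: inner_simps)
    ultimately show ?thesis by (simp add: field_simps)
  qed
  have "dw \<bullet> (x + dx - y') = 1 / (\<sigma> * \<beta>) * (norm dw)\<^sup>2"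
    using u_step'[of "Suc k"] by (simp add: next_eqs power2_norm_eq_inner flip: defs)
  moreover have "L (Suc k) = fr (Suc k) + gr (Suc k) + H (x + dx) (p + dp) + w \<bullet> (x + dx - y')
      + dw \<bullet> (x + dx - y') + \<beta> / 2 * (norm (x + dx - y'))\<^sup>2"
    unfolding L_def next_eqs defs(8)[symmetric] by (simp add: inner_add_left)
  moreover have "L k = fr k + gr k + H x p + w \<bullet> (x - y) + \<beta> / 2 * (norm (x - y))\<^sup>2"
    unfolding L_def defs(1-4) ..
  ultimately show ?thesis using P_update z_update W_update by (simp flip: defs)
qed

text \<open>
  The increase of the augmented Lagrangian can be absorbed by the correction terms of \<open>\<psi>\<close> because
  \<open>v\<close> obeys a contraction, perturbed by terms of the size of the steps in \<open>W\<close> and \<open>P\<close>. Convexity of the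
  squared norm is what keeps the factor \<open>1 - \<sigma>\<close>.
\<close>

lemma v_contraction:
  "(norm (v (Suc k)))\<^sup>2 \<le> (1 - \<sigma>) * (norm (v k))\<^sup>2
     + \<sigma> * (2 * (\<sigma> * \<tau> + \<kappa>\<^sub>1)\<^sup>2 * (norm (dW k))\<^sup>2 + 2 * \<kappa>\<^sub>3\<^sup>2 * (norm (dP (Suc k)))\<^sup>2)"
proof -
  define e where "e = (s *\<^sub>R dW k - a (dW k)) + (- b (dP (Suc k)))"
  have u_rec: "u (Suc k) + s *\<^sub>R dW k = (1 - \<sigma>) *\<^sub>R u k - \<sigma> *\<^sub>R GW (W k) (P (Suc k))" for k
  proof -
    have eq: "GW (W k) (P (Suc k)) + u k + \<beta> *\<^sub>R (W (Suc k) - z (Suc k)) - \<beta> *\<^sub>R dW k = - \<tau> *\<^sub>R dW k"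
      using W_step'[of k] by (simp add: dW_def algebra_simps)
    have "\<sigma> *\<^sub>R (\<beta> *\<^sub>R (W (Suc k) - z (Suc k))) = u (Suc k) - u k"
      by (simp add: u_step[of k])
    moreover have "\<sigma> *\<^sub>R (GW (W k) (P (Suc k)) + u k + \<beta> *\<^sub>R (W (Suc k) - z (Suc k)) - \<beta> *\<^sub>R dW k)
        = \<sigma> *\<^sub>R (- \<tau> *\<^sub>R dW k)"
      by (simp only: eq)
    ultimately have "\<sigma> *\<^sub>R GW (W k) (P (Suc k)) + \<sigma> *\<^sub>R u k + (u (Suc k) - u k) - \<sigma> *\<^sub>R \<beta> *\<^sub>R dW k
        = \<sigma> *\<^sub>R (- \<tau> *\<^sub>R dW k)"
      by (simp only: scaleR_add_right scaleR_diff_right[of \<sigma> _ "\<beta> *\<^sub>R dW k"])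
    then show ?thesis by (simp add: s_def algebra_simps)
  qed
  have "GW (W (Suc k)) (P (Suc (Suc k))) - GW (W k) (P (Suc k)) = a (dW k) + b (dP (Suc k))"
    by (simp add: GW_def dW_def dP_def lin_simps)
  moreover have "v (Suc k) = (u (Suc (Suc k)) + s *\<^sub>R dW (Suc k)) - (u (Suc k) + s *\<^sub>R dW k) + s *\<^sub>R dW k"
    by (simp add: v_def du_def)
  ultimately have "v (Suc k) = (1 - \<sigma>) *\<^sub>R du k - \<sigma> *\<^sub>R (a (dW k) + b (dP (Suc k))) + s *\<^sub>R dW k"
    unfolding u_rec by (simp add: du_def algebra_simps)
  also have "\<dots> = (1 - \<sigma>) *\<^sub>R v k + \<sigma> *\<^sub>R e"
    by (simp add: v_def e_def algebra_simps)
  finally have "(norm (v (Suc k)))\<^sup>2 \<le> (1 - \<sigma>) * (norm (v k))\<^sup>2 + \<sigma> * (norm e)\<^sup>2"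
    using norm_convex_comb_sq[of \<sigma> "v k" e] \<sigma>_pos \<sigma>_less by simp
  also have "(norm e)\<^sup>2 \<le> 2 * (norm (s *\<^sub>R dW k - a (dW k)))\<^sup>2 + 2 * (norm (- b (dP (Suc k))))\<^sup>2"
    unfolding e_def by (rule norm_sum_sq_le)
  finally have main: "(norm (v (Suc k)))\<^sup>2 \<le> (1 - \<sigma>) * (norm (v k))\<^sup>2
      + \<sigma> * (2 * (norm (s *\<^sub>R dW k - a (dW k)))\<^sup>2 + 2 * (norm (- b (dP (Suc k))))\<^sup>2)"
    using \<sigma>_pos by simp
  have "norm (s *\<^sub>R dW k - a (dW k)) \<le> (\<sigma> * \<tau> + \<kappa>\<^sub>1) * norm (dW k)"
  proof -
    have "norm (s *\<^sub>R dW k - a (dW k)) \<le> \<bar>s\<bar> * norm (dW k) + norm (a (dW k))"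
      using norm_triangle_ineq4[of "s *\<^sub>R dW k" "a (dW k)"] by simp
    also have "\<dots> \<le> (\<sigma> * \<tau>) * norm (dW k) + \<kappa>\<^sub>1 * norm (dW k)"
      by (intro add_mono mult_right_mono s_abs a_norm) auto
    finally show ?thesis by (simp add: algebra_simps)
  qed
  then have "(norm (s *\<^sub>R dW k - a (dW k)))\<^sup>2 \<le> ((\<sigma> * \<tau> + \<kappa>\<^sub>1) * norm (dW k))\<^sup>2"
    by (intro power_mono) auto
  moreover have "(norm (- b (dP (Suc k))))\<^sup>2 \<le> (\<kappa>\<^sub>3 * norm (dP (Suc k)))\<^sup>2"
    using b_norm by (intro power_mono) auto
  ultimately have "\<sigma> * (2 * (norm (s *\<^sub>R dW k - a (dW k)))\<^sup>2 + 2 * (norm (- b (dP (Suc k))))\<^sup>2)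
      \<le> \<sigma> * (2 * ((\<sigma> * \<tau> + \<kappa>\<^sub>1) * norm (dW k))\<^sup>2 + 2 * (\<kappa>\<^sub>3 * norm (dP (Suc k)))\<^sup>2)"
    using \<sigma>_pos by (intro mult_left_mono add_mono) auto
  then show ?thesis using main by (simp only: power_mult_distrib mult.assoc)
qed

text \<open>
  The decrease rates of \<open>\<psi>\<close> with respect to the steps in \<open>W\<close> and \<open>P\<close>.
\<close>

definition cW :: real where
  "cW = \<tau> - (\<beta> + \<kappa>\<^sub>1) / 2 - C1 - 4 * \<sigma> * \<tau>\<^sup>2 / \<beta>"

definition cP :: real where
  "cP = (\<mu> - \<kappa>\<^sub>2) / 2 - 8 * \<kappa>\<^sub>3\<^sup>2 / (\<sigma> * \<beta>)"

lemma cW_pos: "0 < cW" and cP_pos: "0 < cP"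
proof -
  have "C1 = 8 * \<sigma> * \<tau>\<^sup>2 / \<beta> + 16 * \<kappa>\<^sub>1 * \<tau> / \<beta> + 8 * \<kappa>\<^sub>1\<^sup>2 / (\<sigma> * \<beta>)"
    using \<sigma>_pos \<beta>_pos by (simp add: C1_def power2_eq_square field_simps)
  moreover have "12 * \<sigma> * \<tau>\<^sup>2 / \<beta> = 8 * \<sigma> * \<tau>\<^sup>2 / \<beta> + 4 * \<sigma> * \<tau>\<^sup>2 / \<beta>"
    using \<beta>_pos by (simp add: field_simps)
  ultimately show "0 < cW" using \<tau>_margin unfolding cW_def by linarith
  show "0 < cP" using \<mu>_large unfolding cP_def by (simp add: field_simps)
qed

text \<open>
  The squared step \<open>(norm (du (Suc k)))\<^sup>2\<close> is estimated with twice the coefficient with which it appears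
  in the estimate of the augmented Lagrangian: one half cancels the increase there, the other half is the decrease stated here.
\<close>

lemma \<psi>r_descent:
  "\<psi>r (Suc k) + cW * (norm (dW (Suc k)))\<^sup>2 + cP * (norm (dP (Suc k)))\<^sup>2
     + 1 / (\<sigma> * \<beta>) * (norm (du (Suc k)))\<^sup>2 \<le> \<psi>r k"
proof -
  have \<sigma>\<beta>: "0 < \<sigma> * \<beta>" using \<sigma>_pos \<beta>_pos by simp
  define D where "D = 1 / (\<sigma> * \<beta>)"
  have D: "0 < D" using \<sigma>\<beta> by (simp add: D_def)
  define V V' Wk Wk' Pk Uk where
    "V = (norm (v k))\<^sup>2" "V' = (norm (v (Suc k)))\<^sup>2" "Wk = (norm (dW k))\<^sup>2" "Wk' = (norm (dW (Suc k)))\<^sup>2"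
    "Pk = (norm (dP (Suc k)))\<^sup>2" "Uk = (norm (du (Suc k)))\<^sup>2"
  note defs = V_V'_Wk_Wk'_Pk_Uk_def
  have "du (Suc k) = v (Suc k) + (- s) *\<^sub>R dW (Suc k)" by (simp add: v_def)
  then have "Uk \<le> 2 * V' + 2 * (norm ((- s) *\<^sub>R dW (Suc k)))\<^sup>2"
    unfolding defs using norm_sum_sq_le by metis
  also have "(norm ((- s) *\<^sub>R dW (Suc k)))\<^sup>2 = s\<^sup>2 * Wk'" by (simp add: defs power_mult_distrib)
  also have "s\<^sup>2 * Wk' \<le> (\<sigma> * \<tau>)\<^sup>2 * Wk'"
    by (intro mult_right_mono s_sq) (simp add: defs)
  finally have "2 * D * Uk \<le> 2 * D * (2 * V' + 2 * ((\<sigma> * \<tau>)\<^sup>2 * Wk'))"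
    using D by (intro mult_left_mono) auto
  also have "\<dots> = 4 * D * V' + 4 * \<sigma> * \<tau>\<^sup>2 / \<beta> * Wk'"
    using \<sigma>_pos \<beta>_pos by (simp add: D_def field_simps power2_eq_square)
  finally have U: "2 * D * Uk \<le> 4 * D * V' + 4 * \<sigma> * \<tau>\<^sup>2 / \<beta> * Wk'" .
  have "V' \<le> (1 - \<sigma>) * V + \<sigma> * (2 * (\<sigma> * \<tau> + \<kappa>\<^sub>1)\<^sup>2 * Wk + 2 * \<kappa>\<^sub>3\<^sup>2 * Pk)"
    using v_contraction[of k] unfolding defs .
  then have "4 * D / \<sigma> * V' \<le> 4 * D / \<sigma> * ((1 - \<sigma>) * V + \<sigma> * (2 * (\<sigma> * \<tau> + \<kappa>\<^sub>1)\<^sup>2 * Wk + 2 * \<kappa>\<^sub>3\<^sup>2 * Pk))"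
    using D \<sigma>_pos by (intro mult_left_mono) auto
  also have "\<dots> = C0 * V + C1 * Wk + 8 * \<kappa>\<^sub>3\<^sup>2 / (\<sigma> * \<beta>) * Pk"
    using \<sigma>_pos \<beta>_pos by (simp add: D_def C0_def C1_def field_simps power2_eq_square)
  also have "4 * D / \<sigma> * V' = C0 * V' + 4 * D * V'"
    using \<sigma>_pos \<beta>_pos by (simp add: D_def C0_def field_simps power2_eq_square)
  finally have V: "C0 * V' + 4 * D * V' \<le> C0 * V + C1 * Wk + 8 * \<kappa>\<^sub>3\<^sup>2 / (\<sigma> * \<beta>) * Pk" .
  have \<psi>r: "\<psi>r j = fr j + gr j + H (W (Suc j)) (P (Suc j)) + u (Suc j) \<bullet> (W (Suc j) - z (Suc j))
      + \<beta> / 2 * (norm (W (Suc j) - z (Suc j)))\<^sup>2 + C0 * (norm (v j))\<^sup>2 + C1 * (norm (dW j))\<^sup>2" for j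
    by (simp add: \<psi>r_def S_def X_def v_def dW_def du_def)
  show ?thesis
    using lagrangian_descent[of k] U V
    unfolding \<psi>r cW_def cP_def D_def[symmetric] defs[symmetric] left_diff_distrib by linarith
qed

lemma tendsto_Suc_shift:
  "(\<lambda>k. W (Suc k)) \<longlonglongrightarrow> Wstar" "(\<lambda>k. P (Suc k)) \<longlonglongrightarrow> Pstar"
  "(\<lambda>k. z (Suc k)) \<longlonglongrightarrow> zstar" "(\<lambda>k. u (Suc k)) \<longlonglongrightarrow> ustar"
  using lims by (auto intro: LIMSEQ_Suc)

lemma X_tendsto: "X \<longlonglongrightarrow> Xstar"
  unfolding X_def Xstar_def by (intro tendsto_intros lims tendsto_Suc_shift)

lemma A_tendsto: "A \<longlonglongrightarrow> 0"
proof -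
  have "A \<longlonglongrightarrow> norm (Wstar - Wstar) + norm (Pstar - Pstar) + norm (ustar - ustar)"
    unfolding A_def dW_def dP_def du_def by (intro tendsto_intros lims tendsto_Suc_shift)
  then show ?thesis by simp
qed

lemma d_tendsto: "d \<longlonglongrightarrow> 0"
proof -
  obtain B where B: "\<And>k. norm (d k) \<le> B * A k" using d_bound by blast
  show ?thesis
  proof (rule Lim_null_comparison)
    show "\<forall>\<^sub>F k in sequentially. norm (d k) \<le> B * A k" using B by simp
    show "(\<lambda>k. B * A k) \<longlonglongrightarrow> 0" using tendsto_mult_right_zero[OF A_tendsto] .
  qed
qed

lemma S_tendsto: "(\<lambda>k. S (X k)) \<longlonglongrightarrow> S Xstar"
  unfolding S_def X_def Xstar_def prod.case
  by (intro tendsto_intros tendsto_H lims tendsto_Suc_shift)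

lemma \<psi>r_Suc_le: "\<psi>r (Suc k) \<le> \<psi>r k"
proof -
  have "0 \<le> cW * (norm (dW (Suc k)))\<^sup>2" "0 \<le> cP * (norm (dP (Suc k)))\<^sup>2"
    "0 \<le> 1 / (\<sigma> * \<beta>) * (norm (du (Suc k)))\<^sup>2"
    using cW_pos cP_pos \<sigma>_pos \<beta>_pos by auto
  then show ?thesis using \<psi>r_descent[of k] by linarith
qed

lemma \<psi>r_antimono: "i \<le> j \<Longrightarrow> \<psi>r j \<le> \<psi>r i"
  using \<psi>r_Suc_le lift_Suc_antimono_le by blast

text \<open>
  Lower semicontinuity of \<open>\<psi>\<close> and monotonicity of \<open>\<psi>r\<close> force the limit point into the domain.
\<close>

lemma limit_finite:
  obtains f0 g0 where "f zstar = ereal f0" "g Pstar = ereal g0"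
proof -
  have lsc: "lower_semicontinuous \<psi>" using loj by (simp add: lojasiewicz_def)
  have "\<psi> Xstar \<noteq> \<infinity>"
  proof
    assume "\<psi> Xstar = \<infinity>"
    then have "\<forall>\<^sub>F k in sequentially. ereal (\<psi>r 0) < \<psi> (X k)"
      using lower_semicontinuous_eventually[OF lsc X_tendsto] by simp
    then obtain k where "\<psi>r 0 < \<psi>r k" by (auto simp: \<psi>_X eventually_sequentially)
    then show False using \<psi>r_antimono[of 0 k] by simp
  qed
  then have "f zstar + g Pstar + ereal (S Xstar) \<noteq> \<infinity>" by (simp add: Xstar_def \<psi>_eq)
  then show ?thesis
    using f_ninf[of zstar] g_ninf[of Pstar] that by (cases "f zstar"; cases "g Pstar") auto
qed

definition \<psi>star :: real where "\<psi>star = real_of_ereal (\<psi> Xstar)"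

lemma \<psi>_Xstar: "\<psi> Xstar = ereal \<psi>star" and \<psi>r_tendsto: "\<psi>r \<longlonglongrightarrow> \<psi>star"
proof -
  obtain f0 g0 where fg: "f zstar = ereal f0" "g Pstar = ereal g0" by (rule limit_finite)
  have eq: "\<psi> Xstar = ereal (f0 + g0 + S Xstar)" using fg by (simp add: Xstar_def \<psi>_eq)
  then show \<psi>_Xstar: "\<psi> Xstar = ereal \<psi>star" by (simp add: \<psi>star_def)
  \<comment> \<open>comparing the proximal step with the limit point gives the upper bound\<close>
  define h where "h k = f0 + g0 + S (X k) - \<zeta> k \<bullet> (zstar - z (Suc k)) + \<beta> / 2 * (norm (zstar - z (Suc k)))\<^sup>2
      - \<xi> k \<bullet> (Pstar - P (Suc k)) + \<mu> / 2 * (norm (Pstar - P (Suc k)))\<^sup>2" for k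
  have le: "\<psi>r k \<le> h k" for k
    using f_minorant[of k zstar] g_minorant[of k Pstar] fg by (simp add: \<psi>r_def h_def)
  have "\<zeta> \<longlonglongrightarrow> \<beta> *\<^sub>R (Wstar - zstar) + ustar"
    unfolding \<zeta>_def by (intro tendsto_intros lims tendsto_Suc_shift)
  moreover have "\<xi> \<longlonglongrightarrow> \<mu> *\<^sub>R (Pstar - Pstar) - GP Wstar Pstar"
    unfolding \<xi>_def GP_def by (intro tendsto_intros lims tendsto_Suc_shift tendsto_lin[OF lims(1,2)])
  ultimately have "h \<longlonglongrightarrow> f0 + g0 + S Xstar - (\<beta> *\<^sub>R (Wstar - zstar) + ustar) \<bullet> (zstar - zstar)
      + \<beta> / 2 * (norm (zstar - zstar))\<^sup>2 - (\<mu> *\<^sub>R (Pstar - Pstar) - GP Wstar Pstar) \<bullet> (Pstar - Pstar)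
      + \<mu> / 2 * (norm (Pstar - Pstar))\<^sup>2"
    unfolding h_def by (intro tendsto_intros S_tendsto tendsto_Suc_shift)
  then have h: "h \<longlonglongrightarrow> \<psi>star" using eq \<psi>_Xstar by simp
  show "\<psi>r \<longlonglongrightarrow> \<psi>star"
  proof (rule order_tendstoI)
    fix e assume "e < \<psi>star"
    then have "\<forall>\<^sub>F k in sequentially. ereal e < \<psi> (X k)"
      using lower_semicontinuous_eventually[OF _ X_tendsto] loj \<psi>_Xstar by (simp add: lojasiewicz_def)
    then show "\<forall>\<^sub>F k in sequentially. e < \<psi>r k" by (simp add: \<psi>_X)
  next
    fix e assume "\<psi>star < e"
    then have "\<forall>\<^sub>F k in sequentially. h k < e" using order_tendstoD(2)[OF h] by blast
    then show "\<forall>\<^sub>F k in sequentially. \<psi>r k < e"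
      by eventually_elim (use le in \<open>auto intro: le_less_trans\<close>)
  qed
qed

lemma Xstar_critical: "0 \<in> limiting_subdiff \<psi> Xstar"
proof -
  have "Xstar \<in> edom \<psi>" by (simp add: edom_def \<psi>_Xstar)
  moreover have "(\<lambda>k. \<psi> (X k)) \<longlonglongrightarrow> \<psi> Xstar"
    using \<psi>r_tendsto by (simp add: \<psi>_X \<psi>_Xstar)
  ultimately show ?thesis
    using X_tendsto d_tendsto d_subgradient unfolding limiting_subdiff_def by blast
qed

text \<open>
  The gap to the limiting value.
\<close>

definition E :: "nat \<Rightarrow> real" where "E k = \<psi>r k - \<psi>star"

lemma E_nonneg: "0 \<le> E k"
  using \<psi>r_antimono decseq_ge[OF _ \<psi>r_tendsto] by (simp add: E_def monotone_def)

lemma E_error_bound: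
  obtains B K where "0 < B" and "\<And>k. K \<le> k \<Longrightarrow> E k powr \<theta> \<le> B * A k"
proof -
  obtain L \<epsilon> where L: "0 < L" "0 < \<epsilon>"
    "\<And>Y. Y \<in> ball Xstar \<epsilon> \<Longrightarrow> epowr \<bar>\<psi> Y - \<psi> Xstar\<bar> \<theta> \<le> ereal L * dist0 (limiting_subdiff \<psi> Y)"
    using loj Xstar_critical unfolding lojasiewicz_def by blast
  obtain B where B: "0 < B" "\<And>k. norm (d k) \<le> B * A k" using d_bound by blast
  have "\<forall>\<^sub>F k in sequentially. X k \<in> ball Xstar \<epsilon>"
    using X_tendsto L(2) by (intro topological_tendstoD) auto
  then obtain K where K: "\<And>k. K \<le> k \<Longrightarrow> X k \<in> ball Xstar \<epsilon>"
    by (auto simp: eventually_sequentially)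
  have "E k powr \<theta> \<le> (L * B) * A k" if "K \<le> k" for k
  proof -
    have "d k \<in> limiting_subdiff \<psi> (X k)" by (intro frechet_subset_limiting d_subgradient)
    then have "dist0 (limiting_subdiff \<psi> (X k)) \<le> ereal (norm (d k))"
      unfolding dist0_def by (rule INF_lower)
    then have "ereal L * dist0 (limiting_subdiff \<psi> (X k)) \<le> ereal L * ereal (norm (d k))"
      using L(1) by (intro ereal_mult_left_mono) auto
    then have "epowr \<bar>\<psi> (X k) - \<psi> Xstar\<bar> \<theta> \<le> ereal L * ereal (norm (d k))"
      using L(3)[OF K[OF that]] by (rule order_trans[rotated])
    then have "E k powr \<theta> \<le> L * norm (d k)"
      using E_nonneg[of k] by (simp add: \<psi>_X \<psi>_Xstar epowr_def E_def)
    also have "\<dots> \<le> L * (B * A k)" using B L by (intro mult_left_mono) auto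
    finally show ?thesis by simp
  qed
  then show ?thesis using that[of "L * B" K] B L by simp
qed

lemma E_descent: obtains \<eta> where "0 < \<eta>" "\<And>k. E (Suc k) + \<eta> * (A (Suc k))\<^sup>2 \<le> E k"
proof -
  define m where "m = min cW (min cP (1 / (\<sigma> * \<beta>)))"
  have m: "0 < m" "m \<le> cW" "m \<le> cP" "m \<le> 1 / (\<sigma> * \<beta>)"
    using cW_pos cP_pos \<sigma>_pos \<beta>_pos by (auto simp: m_def)
  have "E (Suc k) + m / 3 * (A (Suc k))\<^sup>2 \<le> E k" for k
  proof -
    define p q r where "p = norm (dW (Suc k))" "q = norm (dP (Suc k))" "r = norm (du (Suc k))"
    have "3 * (p\<^sup>2 + q\<^sup>2 + r\<^sup>2) - (p + q + r)\<^sup>2 = (p - q)\<^sup>2 + (q - r)\<^sup>2 + (p - r)\<^sup>2"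
      by (simp add: power2_eq_square algebra_simps)
    moreover have "0 \<le> (p - q)\<^sup>2 + (q - r)\<^sup>2 + (p - r)\<^sup>2" by simp
    ultimately have "(p + q + r)\<^sup>2 \<le> 3 * (p\<^sup>2 + q\<^sup>2 + r\<^sup>2)" by linarith
    then have "m * ((p + q + r)\<^sup>2) \<le> m * (3 * (p\<^sup>2 + q\<^sup>2 + r\<^sup>2))"
      using m by (intro mult_left_mono) auto
    moreover have "m * p\<^sup>2 \<le> cW * p\<^sup>2" "m * q\<^sup>2 \<le> cP * q\<^sup>2" "m * r\<^sup>2 \<le> 1 / (\<sigma> * \<beta>) * r\<^sup>2"
      using m by (intro mult_right_mono; simp)+
    ultimately have "m / 3 * (A (Suc k))\<^sup>2 \<le> cW * p\<^sup>2 + cP * q\<^sup>2 + 1 / (\<sigma> * \<beta>) * r\<^sup>2"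
      unfolding A_def p_q_r_def[symmetric] by (simp add: algebra_simps)
    then show ?thesis
      using \<psi>r_descent[of k] unfolding E_def p_q_r_def by linarith
  qed
  then show ?thesis using that[of "m / 3"] m by simp
qed

lemma zstar_eq: "zstar = Wstar"
proof -
  have "(\<lambda>k. (1 / (\<sigma> * \<beta>)) *\<^sub>R du k) \<longlonglongrightarrow> (1 / (\<sigma> * \<beta>)) *\<^sub>R (ustar - ustar)"
    unfolding du_def by (intro tendsto_intros lims tendsto_Suc_shift)
  then have "(\<lambda>k. W (Suc k) - z (Suc k)) \<longlonglongrightarrow> 0" by (simp add: u_step')
  moreover have "(\<lambda>k. W (Suc k) - z (Suc k)) \<longlonglongrightarrow> Wstar - zstar"
    by (intro tendsto_intros tendsto_Suc_shift)
  ultimately have "Wstar - zstar = 0" by (rule LIMSEQ_unique[rotated])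
  then show ?thesis by simp
qed

theorem rates:
  shows "\<theta> \<le> 1 / 2 \<longrightarrow>
       (\<exists>k0::nat. \<exists>p>0. \<exists>r\<in>{0<..<1}. \<forall>k\<ge>k0.
          norm (W k - Wstar) \<le> p * r ^ k \<and> norm (P k - Pstar) \<le> p * r ^ k \<and>
          norm (z k - zstar) \<le> p * r ^ k \<and> norm (u k - ustar) \<le> p * r ^ k)" (is "_ \<longrightarrow> ?linear")
    and "1 / 2 < \<theta> \<longrightarrow>
       (\<exists>k1::nat. \<exists>p>0. \<forall>k\<ge>k1.
          norm (W k - Wstar) \<le> p * real k powr (- ((1 - \<theta>) / (2 * \<theta> - 1))) \<and>
          norm (P k - Pstar) \<le> p * real k powr (- ((1 - \<theta>) / (2 * \<theta> - 1))) \<and>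
          norm (z k - zstar) \<le> p * real k powr (- ((1 - \<theta>) / (2 * \<theta> - 1))) \<and>
          norm (u k - ustar) \<le> p * real k powr (- ((1 - \<theta>) / (2 * \<theta> - 1))))" (is "_ \<longrightarrow> ?sublinear")
proof -
  obtain \<eta> where \<eta>: "0 < \<eta>" "\<And>k. E (Suc k) + \<eta> * (A (Suc k))\<^sup>2 \<le> E k" using E_descent by blast
  obtain B K where BK: "0 < B" "\<And>k. K \<le> k \<Longrightarrow> E k powr \<theta> \<le> B * A k" using E_error_bound by blast
  have A_nonneg: "0 \<le> A k" for k by (simp add: A_def)
  have E_lim: "E \<longlonglongrightarrow> 0" unfolding E_def using \<psi>r_tendsto by (rule LIM_zero)
  interpret loj_descent E A \<eta> B \<theta> K
    by unfold_locales (use \<eta> BK A_nonneg E_nonneg E_lim \<theta>_pos loj in \<open>auto simp: lojasiewicz_def\<close>)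
  define e where "e = min (1/2) (1 - \<theta>)"
  have e: "0 < e" using \<theta>_less by (simp add: e_def)
  obtain T K' where T: "0 < T" and path: "\<And>k n. K' \<le> k \<Longrightarrow> sum A {Suc k..<n} \<le> T * E k powr e"
    unfolding e_def using path_length_le by blast
  \<comment> \<open>the second summand accounts for \<open>z\<close>, which differs from \<open>W\<close> by a multiple of the multiplier step\<close>
  define p where "p = T + T / (\<sigma> * \<beta>)"
  have p: "0 < p" using T \<sigma>_pos \<beta>_pos by (simp add: p_def add_pos_pos)
  have dists: "norm (W (k + 2) - Wstar) \<le> p * E k powr e \<and> norm (P (k + 2) - Pstar) \<le> p * E k powr e \<and>
      norm (z (k + 2) - zstar) \<le> p * E k powr e \<and> norm (u (k + 2) - ustar) \<le> p * E k powr e"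
    if "K' \<le> k" for k
  proof -
    have "E (Suc k) powr e \<le> E k powr e"
      using E_Suc_le E_nonneg e by (intro powr_mono2) auto
    then have "T * E (Suc k) powr e \<le> T * E k powr e" using T by simp
    then have "sum A {Suc (Suc k)..<n} \<le> T * E k powr e" for n
      using path[of "Suc k" n] that by simp
    note bound = dist_limit_le_path_length[OF _ _ this]
    have W: "norm (W (k + 2) - Wstar) \<le> T * E k powr e"
      using bound[OF lims(1)] by (simp add: A_def dW_def)
    have P: "norm (P (k + 2) - Pstar) \<le> T * E k powr e"
      using bound[OF lims(2)] by (simp add: A_def dP_def)
    have U: "norm (u (k + 2) - ustar) \<le> T * E k powr e"
      using bound[OF lims(4)] by (simp add: A_def du_def)
    have "norm (du (Suc k)) \<le> A (Suc k)" by (simp add: A_def)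
    also have "\<dots> \<le> T * E k powr e" using path[OF that, of "Suc (Suc k)"] by simp
    finally have "1 / (\<sigma> * \<beta>) * norm (du (Suc k)) \<le> 1 / (\<sigma> * \<beta>) * (T * E k powr e)"
      using \<sigma>_pos \<beta>_pos by (intro mult_left_mono) auto
    moreover have "z (k + 2) - zstar = (W (k + 2) - Wstar) - (1 / (\<sigma> * \<beta>)) *\<^sub>R du (Suc k)"
      using u_step'[of "Suc k"] by (simp add: zstar_eq algebra_simps)
    then have "norm (z (k + 2) - zstar) \<le> norm (W (k + 2) - Wstar) + 1 / (\<sigma> * \<beta>) * norm (du (Suc k))"
      using norm_triangle_ineq4[of "W (k + 2) - Wstar" "(1 / (\<sigma> * \<beta>)) *\<^sub>R du (Suc k)"] \<sigma>_pos \<beta>_pos by simp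
    moreover have "p * E k powr e = T * E k powr e + 1 / (\<sigma> * \<beta>) * (T * E k powr e)"
      by (simp add: p_def algebra_simps)
    moreover have "0 \<le> 1 / (\<sigma> * \<beta>) * (T * E k powr e)" using T \<sigma>_pos \<beta>_pos by simp
    ultimately show ?thesis using W P U by linarith
  qed
  show "\<theta> \<le> 1 / 2 \<longrightarrow> ?linear"
  proof
    assume "\<theta> \<le> 1 / 2"
    then obtain D r J where D: "0 < D" "0 < r" "r < 1" "\<And>k. J \<le> k \<Longrightarrow> E k \<le> D * r ^ (k + 2)"
      using E_linear_rate by blast
    have re: "r powr e \<in> {0<..<1}" using D e powr_less_mono2[of e r 1] by simp
    have est: "p * E k powr e \<le> (p * D powr e) * (r powr e) ^ (k + 2)" if "J \<le> k" for k
    proof -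
      have "E k powr e \<le> (D * r ^ (k + 2)) powr e"
        using D(4)[OF that] E_nonneg e by (intro powr_mono2) auto
      also have "\<dots> = D powr e * (r powr e) ^ (k + 2)"
      proof -
        have "(r ^ n) powr e = (r powr e) ^ n" for n
          using D by (simp add: powr_powr mult.commute flip: powr_realpow)
        then show ?thesis using D by (simp add: powr_mult)
      qed
      finally show ?thesis using p by (simp add: mult.assoc)
    qed
    show ?linear
    proof (intro exI[of _ "max J K' + 2"] exI[of _ "p * D powr e"] bexI[of _ "r powr e"] conjI allI impI re)
      show "0 < p * D powr e" using p D by simp
    next
      fix k assume k: "max J K' + 2 \<le> k"
      then obtain j where j: "k = j + 2" "J \<le> j" "K' \<le> j" using that[of "k - 2"] by auto
      show "norm (W k - Wstar) \<le> p * D powr e * (r powr e) ^ k" "norm (P k - Pstar) \<le> p * D powr e * (r powr e) ^ k"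
        "norm (z k - zstar) \<le> p * D powr e * (r powr e) ^ k" "norm (u k - ustar) \<le> p * D powr e * (r powr e) ^ k"
        using dists[OF j(3)] est[OF j(2)] unfolding j(1) by linarith+
    qed
  qed
  show "1 / 2 < \<theta> \<longrightarrow> ?sublinear"
  proof
    assume \<theta>: "1 / 2 < \<theta>"
    then obtain D J where D: "0 < D" "\<And>k. J \<le> k \<Longrightarrow> E k \<le> D * real (k + 2) powr (- (1 / (2 * \<theta> - 1)))"
      using E_sublinear_rate by blast
    let ?q = "- ((1 - \<theta>) / (2 * \<theta> - 1))"
    have est: "p * E k powr e \<le> (p * D powr e) * real (k + 2) powr ?q" if "J \<le> k" for k
    proof -
      have "E k powr e \<le> (D * real (k + 2) powr (- (1 / (2 * \<theta> - 1)))) powr e"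
        using D(2)[OF that] E_nonneg e by (intro powr_mono2) auto
      also have "\<dots> = D powr e * real (k + 2) powr ?q"
        using D \<theta> by (simp add: powr_mult powr_powr e_def min_def)
      finally show ?thesis using p by (simp add: mult.assoc)
    qed
    show ?sublinear
    proof (intro exI[of _ "max J K' + 2"] exI[of _ "p * D powr e"] conjI allI impI)
      show "0 < p * D powr e" using p D by simp
    next
      fix k assume k: "max J K' + 2 \<le> k"
      then obtain j where j: "k = j + 2" "J \<le> j" "K' \<le> j" using that[of "k - 2"] by auto
      show "norm (W k - Wstar) \<le> p * D powr e * real k powr ?q" "norm (P k - Pstar) \<le> p * D powr e * real k powr ?q"
        "norm (z k - zstar) \<le> p * D powr e * real k powr ?q" "norm (u k - ustar) \<le> p * D powr e * real k powr ?q"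
        using dists[OF j(3)] est[OF j(2)] unfolding j(1) by linarith+
    qed
  qed
qed

end

section \<open>The least squares coupling and the parameter conditions\<close>

lemma spectral_norm_nonneg: "0 \<le> spectral_norm (X :: real^'c::finite^'r::finite)"
  unfolding spectral_norm_def
  by (rule onorm_pos_le) simp

lemma norm_matrix_le_spectral_norm:
  "norm ((X :: real^'c::finite^'r::finite) *v x) \<le> spectral_norm X * norm x"
  unfolding spectral_norm_def
  by (rule onorm) simp

lemma transpose_mult_vector:
  "transpose_mult X Y *v p = (\<Sum>k<length X. ((Y ! k) \<bullet> p) *\<^sub>R (X ! k))"
proof (subst vec_eq_iff, intro allI)
  fix i
  have "(transpose_mult X Y *v p) $ i = (\<Sum>j\<in>UNIV. \<Sum>k<length X. (X ! k) $ i * (Y ! k) $ j * p $ j)"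
    by (simp add: matrix_vector_mult_def transpose_mult_def sum_distrib_right)
  also have "\<dots> = (\<Sum>k<length X. \<Sum>j\<in>UNIV. (X ! k) $ i * (Y ! k) $ j * p $ j)"
    by (rule sum.swap)
  also have "\<dots> = (\<Sum>k<length X. ((Y ! k) \<bullet> p) *\<^sub>R (X ! k)) $ i"
    by (simp add: inner_vec_def sum_distrib_left sum_distrib_right mult_ac)
  finally show "(transpose_mult X Y *v p) $ i = (\<Sum>k<length X. ((Y ! k) \<bullet> p) *\<^sub>R (X ! k)) $ i" .
qed

lemma inner_transpose_mult:
  "x \<bullet> (transpose_mult X Y *v p) = (\<Sum>k<length X. ((X ! k) \<bullet> x) * ((Y ! k) \<bullet> p))"
  by (simp add: transpose_mult_vector inner_sum_right inner_commute mult.commute)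

lemma quadratic_coupling_least_squares:
  fixes X :: "(real^'c::finite) list" and Y :: "(real^'d::finite) list"
  assumes len: "length X = length Y" and \<rho>: "0 < \<rho>"
  shows "quadratic_coupling (\<lambda>x. \<rho> *\<^sub>R (transpose_mult X X *v x)) (\<lambda>p. \<rho> *\<^sub>R (transpose_mult X Y *v p))
      (\<lambda>x. \<rho> *\<^sub>R (transpose_mult Y X *v x)) (\<lambda>p. \<rho> *\<^sub>R (transpose_mult Y Y *v p))
      (\<rho> * spectral_norm (transpose_mult X X)) (\<rho> * spectral_norm (transpose_mult Y Y))
      (\<rho> * spectral_norm (transpose_mult X Y))"
proof -
  have lin: "linear (\<lambda>x. \<rho> *\<^sub>R (M *v x))" for M :: "real^'i::finite^'j::finite"
    by (intro linear_compose_scale_right) simp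
  have sym: "x \<bullet> (\<rho> *\<^sub>R (transpose_mult X' X' *v y)) = (\<rho> *\<^sub>R (transpose_mult X' X' *v x)) \<bullet> y"
    for X' :: "(real^'i::finite) list" and x y
    unfolding inner_commute[of _ y] by (simp add: inner_transpose_mult mult.commute)
  have adj: "x \<bullet> (\<rho> *\<^sub>R (transpose_mult X Y *v p)) = (\<rho> *\<^sub>R (transpose_mult Y X *v x)) \<bullet> p" for x p
    unfolding inner_commute[of _ p] by (simp add: inner_transpose_mult len mult.commute)
  have bound: "norm (\<rho> *\<^sub>R (M *v x)) \<le> \<rho> * spectral_norm M * norm x" for M :: "real^'i::finite^'j::finite" and x
    using \<rho> norm_matrix_le_spectral_norm[of M x] by simp
  show ?thesis
    by (intro quadratic_coupling.intro lin sym adj bound mult_nonneg_nonneg spectral_norm_nonneg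
        less_imp_le[OF \<rho>])
qed

lemma H_fun_eq_quadratic:
  assumes len: "length X = length Y"
  shows "H_fun \<rho> X Y x p = (x \<bullet> (\<rho> *\<^sub>R (transpose_mult X X *v x))) / 2
     + x \<bullet> (\<rho> *\<^sub>R (transpose_mult X Y *v p)) + (p \<bullet> (\<rho> *\<^sub>R (transpose_mult Y Y *v p))) / 2"
proof -
  have square_sum: "(\<Sum>k<n. (h k + h' k)\<^sup>2) = (\<Sum>k<n. h k * h k) + 2 * (\<Sum>k<n. h k * h' k) + (\<Sum>k<n. h' k * h' k)"
    for h h' :: "nat \<Rightarrow> real" and n
    by (simp only: power2_sum power2_eq_square[of "h _"] power2_eq_square[of "h' _"]
        sum.distrib sum_distrib_left mult.assoc)
  show ?thesis
    unfolding H_fun_def inner_scaleR_right inner_transpose_mult square_sum len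
    by (simp add: field_simps)
qed

lemma length_concat_const: "(\<And>x. x \<in> set xs \<Longrightarrow> length (h x) = n) \<Longrightarrow> length (concat (map h xs)) = length xs * n"
  by (induction xs) auto

text \<open>
  Both \<^const>\<open>H_fun\<close> and \<^const>\<open>transpose_mult\<close> sum over the rows of their first matrix, so the entries of
  the second one are meaningful only if the numbers of rows agree.
\<close>

lemma length_A_rows_B_rows:
  "length (A_rows ns t :: (real^(('n::{finite, linorder} + 'm::{finite, linorder}) \<times> ('n + 'm))) list)
     = length (B_rows ns t :: (real^('n \<times> 'm)) list)"
  by (simp add: A_rows_def B_rows_def kronecker_def row_list_def length_concat_const)

lemma f_fun_ninf: "f_fun R Q F M x \<noteq> -\<infinity>"
proof -
  have "(\<Sum>i=1..M. delta psd_cone (mvec (Upsilon Q (F i) (unvec x)))) \<ge> 0"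
    by (intro sum_nonneg) (auto simp: delta_def)
  moreover have "delta psd_cone x \<ge> 0" by (auto simp: delta_def)
  ultimately show ?thesis unfolding f_fun_def by auto
qed

text \<open>
  The admissible interval for \<open>\<tau>\<close> lies between the roots of a quadratic polynomial with discriminant
  \<open>vs\<close>, so that the polynomial is negative at \<open>\<tau>\<close>.
\<close>

lemma between_roots:
  fixes \<beta> \<sigma> \<kappa> \<tau> :: real
  defines "vs \<equiv> 1 - 32 * \<kappa> / \<beta> - 128 * \<kappa>\<^sup>2 / \<beta>\<^sup>2 - 24 * \<kappa> * \<sigma> / \<beta> - 24 * \<sigma>"
  assumes "0 < \<beta>" "0 < \<sigma>" "0 < vs"
    and lo: "\<beta> / (24 * \<sigma>) * (1 - 16 * \<kappa> / \<beta> - sqrt vs) < \<tau>"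
    and hi: "\<tau> < \<beta> / (24 * \<sigma>) * (1 - 16 * \<kappa> / \<beta> + sqrt vs)"
  shows "(\<beta> + \<kappa>) / 2 + 8 * \<kappa>\<^sup>2 / (\<sigma> * \<beta>) + 16 * \<kappa> * \<tau> / \<beta> + 12 * \<sigma> * \<tau>\<^sup>2 / \<beta> < \<tau>"
proof -
  \<comment> \<open>completing the square\<close>
  define y where "y = 24 * \<sigma> * \<tau> / \<beta> - (1 - 16 * \<kappa> / \<beta>)"
  have "\<beta> / (24 * \<sigma>) * t < \<tau> \<longleftrightarrow> t < 24 * \<sigma> * \<tau> / \<beta>"
    "\<tau> < \<beta> / (24 * \<sigma>) * t \<longleftrightarrow> 24 * \<sigma> * \<tau> / \<beta> < t" for t
    using \<open>0 < \<beta>\<close> \<open>0 < \<sigma>\<close> by (simp_all add: field_simps)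
  then have "- sqrt vs < y" "y < sqrt vs"
    using lo hi by (simp_all add: y_def)
  then have "\<bar>y\<bar> < sqrt vs" by simp
  then have "y\<^sup>2 < vs" by (metis real_sqrt_abs real_sqrt_less_iff)
  moreover have "y\<^sup>2 - vs = 48 * \<sigma> / \<beta> * ((\<beta> + \<kappa>) / 2 + 8 * \<kappa>\<^sup>2 / (\<sigma> * \<beta>) + 16 * \<kappa> * \<tau> / \<beta> + 12 * \<sigma> * \<tau>\<^sup>2 / \<beta> - \<tau>)"
    using \<open>0 < \<beta>\<close> \<open>0 < \<sigma>\<close> by (simp add: y_def vs_def field_simps power2_eq_square)
  ultimately have "48 * \<sigma> / \<beta> * ((\<beta> + \<kappa>) / 2 + 8 * \<kappa>\<^sup>2 / (\<sigma> * \<beta>) + 16 * \<kappa> * \<tau> / \<beta> + 12 * \<sigma> * \<tau>\<^sup>2 / \<beta> - \<tau>) < 0"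
    by linarith
  moreover have "0 < 48 * \<sigma> / \<beta>" using \<open>0 < \<beta>\<close> \<open>0 < \<sigma>\<close> by simp
  ultimately show ?thesis by (metis mult_less_0_iff diff_less_0_iff_less order_less_asym)
qed

theorem theorem5:
  fixes A :: "real^'n::{finite, linorder}^'n::{finite, linorder}"
    and B2 :: "real^'m::{finite, linorder}^'n::{finite, linorder}"
    and B1 :: "real^'l^'n::{finite, linorder}"
    and C :: "real^'n::{finite, linorder}^'q"
    and D :: "real^'m::{finite, linorder}^'q"
    and Ai :: "nat \<Rightarrow> real^'n::{finite, linorder}^'n::{finite, linorder}" and B2i :: "nat \<Rightarrow> real^'m::{finite, linorder}^'n::{finite, linorder}" and M :: nat
    and ms ns :: "nat \<Rightarrow> nat" and s t :: nat
    and Q R :: "real^('n + 'm)^('n + 'm)" and F :: "nat \<Rightarrow> real^('n + 'm)^('n + 'm)"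
    and f :: "real^(('n + 'm) \<times> ('n + 'm)) \<Rightarrow> ereal"
    and g :: "real^('n \<times> 'm) \<Rightarrow> ereal"
    and AA :: "(real^(('n + 'm) \<times> ('n + 'm))) list"
    and BB :: "(real^('n \<times> 'm)) list"
    and H :: "real^(('n + 'm) \<times> ('n + 'm)) \<Rightarrow> real^('n \<times> 'm) \<Rightarrow> real"
    and \<gamma> \<rho> \<mu> \<beta> \<tau> \<sigma> \<kappa>\<^sub>1 \<kappa>\<^sub>2 \<kappa>\<^sub>3 vs \<theta> :: real
    and W z u :: "nat \<Rightarrow> real^(('n + 'm) \<times> ('n + 'm))"
    and P :: "nat \<Rightarrow> real^('n \<times> 'm)"
    and Wstar zstar ustar :: "real^(('n + 'm) \<times> ('n + 'm))"
    and Pstar :: "real^('n \<times> 'm)"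
  assumes "M \<ge> 1"
    and "partition_sizes CARD('m) ms s"
    and "partition_sizes CARD('n) ns t"
    and "Q = Q_mat B1"
    and "R = R_mat C D"
    and "F = (\<lambda>i. F_mat (Ai i) (B2i i))"
    \<comment> \<open>standing assumptions\<close>
    and "transpose C ** D = 0"
    and "posdef (transpose D ** D)"
    and "posdef (transpose C ** C)"
    and "posdef (B1 ** transpose B1)"
    and "stabilizable A B2"
    and "\<not> (\<exists>ev. Re ev = 0 \<and> unobservable_mode A C ev)"
    and "F_mat A B2 \<in> convex hull (F ` {1..M})"
    and "\<exists>X. posdef X \<and> (\<forall>i\<in>{1..M}. posdef (Upsilon Q (F i) X))"
    and "\<forall>X. possemidef X \<and> (\<forall>i\<in>{1..M}. possemidef (Upsilon Q (F i) X)) \<longrightarrow> posdef (upper_left X)"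
    \<comment> \<open>objective and coupling\<close>
    and "\<gamma> > 0" and "\<rho> > 0"
    and "f = f_fun R Q F M"
    and "g = g_fun \<gamma> ms s ns t"
    and "AA = A_rows ns t"
    and "BB = B_rows ns t"
    and "H = H_fun \<rho> AA BB"
    \<comment> \<open>parameters\<close>
    and "\<kappa>\<^sub>1 = \<rho> * spectral_norm (transpose_mult AA AA)"
    and "\<kappa>\<^sub>2 = \<rho> * spectral_norm (transpose_mult BB BB)"
    and "\<kappa>\<^sub>3 = \<rho> * spectral_norm (transpose_mult AA BB)"
    and "0 < \<sigma>" and "\<sigma> < 1 / 24"
    and "\<beta> > 4 * \<kappa>\<^sub>1 / (1 - 24 * \<sigma>) * (4 + 3 * \<sigma> + sqrt (24 - 168 * \<sigma> + 9 * \<sigma>\<^sup>2))"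
    and "4 * \<kappa>\<^sub>1 / (1 - 24 * \<sigma>) * (4 + 3 * \<sigma> + sqrt (24 - 168 * \<sigma> + 9 * \<sigma>\<^sup>2)) > 0"
    and "\<mu> > \<kappa>\<^sub>2 + 16 * \<kappa>\<^sub>3\<^sup>2 / (\<sigma> * \<beta>)"
    and "\<kappa>\<^sub>2 + 16 * \<kappa>\<^sub>3\<^sup>2 / (\<sigma> * \<beta>) > 0"
    and "vs = 1 - 32 * \<kappa>\<^sub>1 / \<beta> - 128 * \<kappa>\<^sub>1\<^sup>2 / \<beta>\<^sup>2 - 24 * \<kappa>\<^sub>1 * \<sigma> / \<beta> - 24 * \<sigma>"
    and "vs > 0"
    and "max (\<beta> / 2) (\<beta> / (24 * \<sigma>) * (1 - 16 * \<kappa>\<^sub>1 / \<beta> - sqrt vs)) < \<tau>"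
    and "\<tau> < \<beta> / (24 * \<sigma>) * (1 - 16 * \<kappa>\<^sub>1 / \<beta> + sqrt vs)"
    \<comment> \<open>the iteration and its limit\<close>
    and "\<And>k. P (Suc k) \<in> prox (inverse \<mu>) g (P k - inverse \<mu> *\<^sub>R gradient (\<lambda>Y. H (W k) Y) (P k))"
    and "\<And>k. z (Suc k) \<in> prox (inverse \<beta>) f (W k + inverse \<beta> *\<^sub>R u k)"
    and "\<And>k. W (Suc k) = W k - inverse \<tau> *\<^sub>R
            (gradient (\<lambda>X. H X (P (Suc k))) (W k) + u k + \<beta> *\<^sub>R (W k - z (Suc k)))"
    and "\<And>k. u (Suc k) = u k + (\<sigma> * \<beta>) *\<^sub>R (W (Suc k) - z (Suc k))"
    and "W \<longlonglongrightarrow> Wstar" and "P \<longlonglongrightarrow> Pstar" and "z \<longlonglongrightarrow> zstar" and "u \<longlonglongrightarrow> ustar"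
    \<comment> \<open>the exponent\<close>
    and "0 < \<theta>" and "\<theta> < 1"
    and "lojasiewicz (Psi f g H \<sigma> \<tau> \<beta> \<kappa>\<^sub>1) \<theta>"
  shows
    "(\<theta> \<le> 1 / 2 \<longrightarrow>
       (\<exists>k\<^sub>0::nat. \<exists>p\<^sub>1>0. \<exists>p\<^sub>2>0. \<exists>p\<^sub>3>0. \<exists>p\<^sub>4>0. \<exists>r\<in>{0<..<1}. \<forall>k\<ge>k\<^sub>0.
          norm (W k - Wstar) \<le> p\<^sub>1 * r ^ k \<and>
          norm (P k - Pstar) \<le> p\<^sub>2 * r ^ k \<and>
          norm (z k - zstar) \<le> p\<^sub>3 * r ^ k \<and>
          norm (u k - ustar) \<le> p\<^sub>4 * r ^ k))
     \<and>
     (1 / 2 < \<theta> \<longrightarrow>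
       (\<exists>k\<^sub>1::nat. \<exists>p\<^sub>1>0. \<exists>p\<^sub>2>0. \<exists>p\<^sub>3>0. \<exists>p\<^sub>4>0. \<forall>k\<ge>k\<^sub>1.
          norm (W k - Wstar) \<le> p\<^sub>1 * real k powr (- ((1 - \<theta>) / (2 * \<theta> - 1))) \<and>
          norm (P k - Pstar) \<le> p\<^sub>2 * real k powr (- ((1 - \<theta>) / (2 * \<theta> - 1))) \<and>
          norm (z k - zstar) \<le> p\<^sub>3 * real k powr (- ((1 - \<theta>) / (2 * \<theta> - 1))) \<and>
          norm (u k - ustar) \<le> p\<^sub>4 * real k powr (- ((1 - \<theta>) / (2 * \<theta> - 1)))))"
proof -
  have len: "length AA = length BB"
    by (simp only: assms(20,21) length_A_rows_B_rows)
  interpret Q: quadratic_coupling "\<lambda>x. \<rho> *\<^sub>R (transpose_mult AA AA *v x)" "\<lambda>p. \<rho> *\<^sub>R (transpose_mult AA BB *v p)"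
      "\<lambda>x. \<rho> *\<^sub>R (transpose_mult BB AA *v x)" "\<lambda>p. \<rho> *\<^sub>R (transpose_mult BB BB *v p)" \<kappa>\<^sub>1 \<kappa>\<^sub>2 \<kappa>\<^sub>3
    unfolding assms(23-25) using len assms(17) by (rule quadratic_coupling_least_squares)
  have H: "H = Q.H"
    by (intro ext) (simp add: assms(22) Q.H_def H_fun_eq_quadratic[OF len])
  have "0 < 4 * \<kappa>\<^sub>1 / (1 - 24 * \<sigma>) * (4 + 3 * \<sigma> + sqrt (24 - 168 * \<sigma> + 9 * \<sigma>\<^sup>2))"
    by (rule assms(29))
  then have \<beta>: "0 < \<beta>" using assms(28) by linarith
  interpret palm "\<lambda>x. \<rho> *\<^sub>R (transpose_mult AA AA *v x)" "\<lambda>p. \<rho> *\<^sub>R (transpose_mult AA BB *v p)"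
      "\<lambda>x. \<rho> *\<^sub>R (transpose_mult BB AA *v x)" "\<lambda>p. \<rho> *\<^sub>R (transpose_mult BB BB *v p)" \<kappa>\<^sub>1 \<kappa>\<^sub>2 \<kappa>\<^sub>3
      f g \<mu> \<beta> \<tau> \<sigma> \<theta> W z u P Wstar zstar ustar Pstar
  proof (unfold_locales, goal_cases)
    case 1 show ?case by (simp add: assms(18) f_fun_ninf)
  next
    case 2 show ?case by (simp add: assms(19) g_fun_def)
  next
    case 3 show ?case by (rule assms(26))
  next
    case 4 show ?case using assms(27) by simp
  next
    case 5 show ?case by (rule \<beta>)
  next
    case 6 show ?case by (rule assms(30))
  next
    case 7 show ?case using assms(34) by simp
  next
    case 8 show ?case
      using assms(33,34,35) unfolding assms(32) by (intro between_roots \<beta> assms(26)) auto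
  next
    case (9 k) show ?case using assms(36)[of k] unfolding H Q.gradient_H .
  next
    case (10 k) show ?case by (rule assms(37))
  next
    case (11 k) show ?case using assms(38)[of k] unfolding H Q.gradient_H .
  next
    case (12 k) show ?case by (rule assms(39))
  next
    case 13 show ?case by (rule assms(40))
  next
    case 14 show ?case by (rule assms(41))
  next
    case 15 show ?case by (rule assms(42))
  next
    case 16 show ?case by (rule assms(43))
  next
    case 17 show ?case by (rule assms(44))
  next
    case 18 show ?case using assms(46) unfolding H .
  qed
  show ?thesis using rates by fast
qed

end
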